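(* The following statements hold for ADAP-NC-FISTA. (a) Every iterate $(y_k,v_k)$ generated by ADAP-NC-FISTA satisfies $v_k\in\nabla f(y_k)+\partial h(y_k)$; moreover, ADAP-NC-FISTA outputs a $\hat\rho$-approximate solution $(\hat y,\hat v)$ (i.e. $\hat v\in\nabla f(\hat y)+\partial h(\hat y)$, $\|\hat v\|\le\hat\rho$) in a number of outer iterations $\mathcal{T}$ bounded by $$\mathcal{T}=\mathcal{O}\left(\left(\frac{C_1\bar M[\phi(y_0)-\phi_*]}{\hat\rho^2}\right)^{1/3}+\left(\frac{C_1\bar Mm_0D_h^2}{\hat\rho^2}\right)^{1/2}+\frac{C_1\bar M[\bar mD_h^2+\phi(y_0)-\phi_*]}{\hat\rho^2}+1\right)$$ where $$C_1:=C_2\max\left\{\frac{\bar m}{m_0},1\right\},\qquad C_2:=\left[\sqrt{\frac{M_0}{\bar M}}+\sqrt{\frac{\bar M}{M_0}}\,\right]^2.$$ (b) If $m_0\ge\bar m$, then an alternative bound on $\mathcal{T}$ is $$\mathcal{T}=\mathcal{O}\left(\left(\frac{C_2\bar M[\phi(y_0)-\phi_*+M_0d_0^2]}{\hat\rho^2}\right)^{1/3}+\left(\frac{C_2\bar Mm_0D_h^2}{\hat\rho^2}\right)^{1/2}+\frac{C_2\bar M\bar mD_h^2}{\hat\rho^2}+1\right).$$ (c) The total number of inner iterations, and hence resolvent evaluations of $h$, performed by ADAP-NC-FISTA is bounded by $$\mathcal{T}+\mathcal{O}\left(\log_1^+\left(\max\left\{\frac{\bar M}{M_0},\frac{\bar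 m}{m_0}\right\}\right)\right),$$ where $\log_1^+(s):=\max\{\log s,1\}$ for $s>0$.
   Context: Problem: $\phi_*:=\min\{\phi(z):=f(z)+h(z): z\in\mathbb{R}^n\}$, where $f$ is real-valued. Standing assumptions: (A1) $h:\mathbb{R}^n\to(-\infty,\infty]$ is proper, lower semicontinuous and convex; (A2) $\mathrm{dom}\,h$ is bounded; (A3) $f$ is differentiable on a closed convex set $\Omega\supseteq\mathrm{dom}\,h$ and there is $M>0$ with $\|\nabla f(z')-\nabla f(z)\|\le M\|z'-z\|$ for all $z,z'\in\Omega$; (A4) $f$ is nonconvex on $\mathrm{dom}\,h$ and there is $m>0$ with $-\frac m2\|z'-z\|^2\le f(z')-f(z)-\langle\nabla f(z),z'-z\rangle$ for all $z,z'\in\Omega$. $\bar M$ (resp. $\bar m$) denotes the smallest $M$ (resp. $m$) for which the inequality in (A3) (resp. (A4)) holds for all $z,z'\in\Omega$; one has $\bar M\ge\bar m>0$. $D_h:=\sup\{\|u'-u\|:u,u'\in\mathrm{dom}\,h\}<\infty$. $Z^*$ is the (nonempty compact) set of optimal solutions and $d_0:=\inf_{z^*\in Z^*}\|z^*-y_0\|$. Notation: $\ell_f(u;\tilde x):=f(\tilde x)+\langle\nabla f(\tilde x),u-\tilde x\rangle$; $P_\Omega$ is the orthogonal projection onto $\Omega$; $\partial h$ is the convex subdifferential. A resolvent evaluation of $h$ is an evaluation of $(I+\tau\partial h)^{-1}(\cdot)$ for some $\tau>0$. ADAP-NC-FISTA: Step 0. Input: $y_0\in\mathrm{dom}\,h$,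 $\theta>1$, a pair $(M_0,m_0)\in\mathbb{R}^2_{++}$ with $M_0\ge m_0$, a tolerance $\hat\rho>0$. Set $x_0=y_0$, $A_0=2$, $\lambda_0=1/M_0$, $k=0$. Step 1. Compute $a_k=\frac{1+\sqrt{1+4A_k}}{2}$, $A_{k+1}=A_k+a_k$, $\tilde x_k=\frac{A_ky_k+a_kx_k}{A_{k+1}}$, $\tilde y_k=\frac{A_ky_k+a_ky_0}{A_{k+1}}$, and $\underline m_{k+1}=\max\left\{\frac{2[\ell_f(\tilde y_k;\tilde x_k)-f(\tilde y_k)]}{\|\tilde y_k-\tilde x_k\|^2},0\right\}$. Step 2. For $\lambda,m>0$ let $y_k(\lambda,m):=\mathrm{argmin}_u\{\ell_f(u;\tilde x_k)+h(u)+\frac12(\frac1\lambda+\frac{2m}{a_k})\|u-\tilde x_k\|^2\}$ and $C_k(\lambda,m):=\frac{2[f(y_k(\lambda,m))-\ell_f(y_k(\lambda,m);\tilde x_k)]}{\|y_k(\lambda,m)-\tilde x_k\|^2}$. Consider the conditions (i) $\lambda C_k(\lambda,m)\le0.9$ and (ii) $2m(\lambda_k-\frac{\lambda}{a_k})\ge\underline m_{k+1}\lambda$. Starting from $(\lambda,m)=(\lambda_k,m_k)$, the subroutine SUB repeats: compute $y_k(\lambda,m)$ and $C_k(\lambda,m)$; if (i) and (ii) both hold, stop and return $(\lambda_{k+1},m_{k+1})=(\lambda,m)$; otherwise, replace $\lambda$ by $\min\{\lambda/\theta,\,0.9/C_k(\lambda,m)\}$ if (i) fails (and leave $\lambda$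 unchanged otherwise), and replace $m$ by $2m$ if (ii) fails (and leave $m$ unchanged otherwise), both conditions being checked at the same current pair. In particular $\lambda_{k+1}\le\lambda_k$ and $m_{k+1}\ge m_k$. Step 3. Set $y_{k+1}=y_k(\lambda_{k+1},m_{k+1})$, $\mathcal{C}_{k+1}=C_k(\lambda_{k+1},m_{k+1})$, $x_{k+1}=P_\Omega\left(\frac{(a_k+2m_{k+1}\lambda_{k+1})y_{k+1}-(a_k-1)y_k}{2m_{k+1}\lambda_{k+1}+1}\right)$, $v_{k+1}=\left(\frac1{\lambda_{k+1}}+\frac{2m_{k+1}}{a_k}\right)(\tilde x_k-y_{k+1})+\nabla f(y_{k+1})-\nabla f(\tilde x_k)$. If $\|v_{k+1}\|\le\hat\rho$, output $(\hat y,\hat v)=(y_{k+1},v_{k+1})$ and stop; otherwise set $k\leftarrow k+1$ and go to Step 1. Any quotient above of the form $0/0$ (which occurs when the denominator vanishes) is taken to be $0$. Iterates $(y_k,v_k)$ are indexed by $k\ge1$. Outer iterations are those indexed by $k$; inner iterations are the passes through the loop of SUB, each of which performs exactly one resolvent evaluation of $h$ (computing $y_k(\lambda,m)$). The constants implied by $\mathcal{O}(\cdot)$ depend only on $\theta$. *)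

theory Defs
  imports "HOL-Analysis.Analysis"
begin

text \<open>
  The space \<open>\<real>\<^sup>n\<close> is represented by a finite-dimensional linear subspace of an arbitrary real inner
  product space \<open>'a\<close>, not by a type such as \<open>real ^ 'n\<close>.  This keeps the dimension inside the logic:
  an infinite-dimensional \<open>'a\<close> contains an isometric copy of every \<open>\<real>\<^sup>n\<close>, so a constant quantified
  outside of the problem data does not depend on the dimension.  The choice \<open>'a = real ^ 'n\<close>,
  \<open>ambient P = UNIV\<close> gives \<open>\<real>\<^sup>n\<close> literally.  Values of the functions outside of \<open>ambient P\<close> are never
  used.
\<close>

record 'a problem =
  ambient :: "'a set"
  smooth_part :: "'a \<Rightarrow> real"         \<comment> \<open>the function \<open>f\<close>\<close>
  nonsmooth_part :: "'a \<Rightarrow> ereal"     \<comment> \<open>the function \<open>h\<close>\<close>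
  feasible_region :: "'a set"          \<comment> \<open>the set \<open>\<Omega>\<close>\<close>


section \<open>The composite problem\<close>

definition dom_h :: "'a problem \<Rightarrow> 'a set" where
  "dom_h P = {z \<in> ambient P. nonsmooth_part P z < \<infinity>}"

text \<open>
  The derivative is taken at \<open>x\<close> within the whole ambient space (not within \<open>\<Omega>\<close>), so the gradient is
  unique even where \<open>\<Omega>\<close> has empty interior.
\<close>

definition grad :: "'a::real_inner problem \<Rightarrow> 'a \<Rightarrow> 'a" where
  "grad P x = (THE g. g \<in> ambient P \<and>
     (smooth_part P has_derivative (\<lambda>u. g \<bullet> u)) (at x within ambient P))"

definition lin_f :: "'a::real_inner problem \<Rightarrow> 'a \<Rightarrow> 'a \<Rightarrow> real" where
  "lin_f P u x = smooth_part P x + grad P x \<bullet> (u - x)"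

definition lipschitz_grad :: "'a::real_inner problem \<Rightarrow> real \<Rightarrow> bool" where
  "lipschitz_grad P M \<longleftrightarrow>
     (\<forall>z \<in> feasible_region P. \<forall>z' \<in> feasible_region P.
        norm (grad P z' - grad P z) \<le> M * norm (z' - z))"

definition lower_curvature :: "'a::real_inner problem \<Rightarrow> real \<Rightarrow> bool" where
  "lower_curvature P m \<longleftrightarrow>
     (\<forall>z \<in> feasible_region P. \<forall>z' \<in> feasible_region P.
        - (m / 2) * (norm (z' - z))\<^sup>2
          \<le> smooth_part P z' - smooth_part P z - grad P z \<bullet> (z' - z))"

definition proper_h :: "'a problem \<Rightarrow> bool" where
  "proper_h P \<longleftrightarrow> (\<forall>z \<in> ambient P. nonsmooth_part P z \<noteq> - \<infinity>) \<and> dom_h P \<noteq> {}"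

definition lsc_h :: "'a::real_inner problem \<Rightarrow> bool" where
  "lsc_h P \<longleftrightarrow>
     (\<forall>z \<in> ambient P. nonsmooth_part P z \<le> Liminf (at z within ambient P) (nonsmooth_part P))"

definition convex_h :: "'a::real_inner problem \<Rightarrow> bool" where
  "convex_h P \<longleftrightarrow>
     (\<forall>x \<in> ambient P. \<forall>y \<in> ambient P. \<forall>t \<in> {0<..<1}.
        nonsmooth_part P ((1 - t) *\<^sub>R x + t *\<^sub>R y)
          \<le> ereal (1 - t) * nonsmooth_part P x + ereal t * nonsmooth_part P y)"

definition composite_problem :: "'a::real_inner problem \<Rightarrow> bool" where
  "composite_problem P \<longleftrightarrow>
     subspace (ambient P) \<and> (\<exists>B. finite B \<and> ambient P = span B) \<and>
     proper_h P \<and> lsc_h P \<and> convex_h P \<and>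
     bounded (dom_h P) \<and>
     closed (feasible_region P) \<and> convex (feasible_region P) \<and>
     dom_h P \<subseteq> feasible_region P \<and> feasible_region P \<subseteq> ambient P \<and>
     (\<forall>z \<in> feasible_region P. smooth_part P differentiable (at z within ambient P)) \<and>
     (\<exists>M>0. lipschitz_grad P M) \<and>
     \<not> convex_on (dom_h P) (smooth_part P) \<and>
     (\<exists>m>0. lower_curvature P m)"

definition M_bar :: "'a::real_inner problem \<Rightarrow> real" where
  "M_bar P = (LEAST M. 0 < M \<and> lipschitz_grad P M)"

definition m_bar :: "'a::real_inner problem \<Rightarrow> real" where
  "m_bar P = (LEAST m. 0 < m \<and> lower_curvature P m)"

definition phi :: "'a problem \<Rightarrow> 'a \<Rightarrow> ereal" where
  "phi P z = ereal (smooth_part P z) + nonsmooth_part P z"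

definition phi_star :: "'a problem \<Rightarrow> ereal" where
  "phi_star P = (INF z \<in> ambient P. phi P z)"

definition optimal_set :: "'a problem \<Rightarrow> 'a set" where
  "optimal_set P = {z \<in> ambient P. phi P z = phi_star P}"

definition primal_gap :: "'a problem \<Rightarrow> 'a \<Rightarrow> real" where
  "primal_gap P y = real_of_ereal (phi P y - phi_star P)"

definition D_h :: "'a::real_inner problem \<Rightarrow> real" where
  "D_h P = diameter (dom_h P)"

definition d_0 :: "'a::real_inner problem \<Rightarrow> 'a \<Rightarrow> real" where
  "d_0 P y\<^sub>0 = infdist y\<^sub>0 (optimal_set P)"

definition subdiff_h :: "'a::real_inner problem \<Rightarrow> 'a \<Rightarrow> 'a set" where
  "subdiff_h P y =
     {w \<in> ambient P. \<forall>u \<in> ambient P.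
        nonsmooth_part P u \<ge> nonsmooth_part P y + ereal (w \<bullet> (u - y))}"

definition stationary_pair :: "'a::real_inner problem \<Rightarrow> 'a \<Rightarrow> 'a \<Rightarrow> bool" where
  "stationary_pair P y v \<longleftrightarrow> v \<in> (\<lambda>w. grad P y + w) ` subdiff_h P y"

definition approx_solution :: "'a::real_inner problem \<Rightarrow> real \<Rightarrow> 'a \<Rightarrow> 'a \<Rightarrow> bool" where
  "approx_solution P \<rho> y v \<longleftrightarrow> stationary_pair P y v \<and> norm v \<le> \<rho>"

definition proj_region :: "'a::real_inner problem \<Rightarrow> 'a \<Rightarrow> 'a" where
  "proj_region P z = arg_min_on (\<lambda>w. norm (w - z)) (feasible_region P)"


section \<open>ADAP-NC-FISTA\<close>

text \<open>
  The state at the start of outer iteration \<open>k\<close>: the data \<open>y\<^sub>k, x\<^sub>k, A\<^sub>k, \<lambda>\<^sub>k, m\<^sub>k\<close>, together with \<open>v\<^sub>k\<close>.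
  The latter is meaningful only for \<open>k \<ge> 1\<close>; its initial value is a dummy.
\<close>

record 'a fista_state =
  st_y :: 'a
  st_x :: 'a
  st_A :: real
  st_lam :: real
  st_m :: real
  st_v :: 'a

definition coef_a :: "'a fista_state \<Rightarrow> real" where
  "coef_a S = (1 + sqrt (1 + 4 * st_A S)) / 2"

definition A_next :: "'a fista_state \<Rightarrow> real" where
  "A_next S = st_A S + coef_a S"

definition x_tilde :: "'a::real_inner fista_state \<Rightarrow> 'a" where
  "x_tilde S = (1 / A_next S) *\<^sub>R (st_A S *\<^sub>R st_y S + coef_a S *\<^sub>R st_x S)"

definition y_tilde :: "'a::real_inner \<Rightarrow> 'a fista_state \<Rightarrow> 'a" where
  "y_tilde y\<^sub>0 S = (1 / A_next S) *\<^sub>R (st_A S *\<^sub>R st_y S + coef_a S *\<^sub>R y\<^sub>0)"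

text \<open>In the two quotients below \<open>x / 0 = 0\<close> realises the convention \<open>0 / 0 = 0\<close>.\<close>

definition m_lower :: "'a::real_inner problem \<Rightarrow> 'a \<Rightarrow> 'a fista_state \<Rightarrow> real" where
  "m_lower P y\<^sub>0 S =
     max (2 * (lin_f P (y_tilde y\<^sub>0 S) (x_tilde S) - smooth_part P (y_tilde y\<^sub>0 S))
            / (norm (y_tilde y\<^sub>0 S - x_tilde S))\<^sup>2) 0"

definition y_trial :: "'a::real_inner problem \<Rightarrow> 'a fista_state \<Rightarrow> real \<Rightarrow> real \<Rightarrow> 'a" where
  "y_trial P S lam m =
     arg_min_on
       (\<lambda>u. ereal (lin_f P u (x_tilde S)) + nonsmooth_part P u
            + ereal (1/2 * (1 / lam + 2 * m / coef_a S) * (norm (u - x_tilde S))\<^sup>2))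
       (ambient P)"

definition C_trial :: "'a::real_inner problem \<Rightarrow> 'a fista_state \<Rightarrow> real \<Rightarrow> real \<Rightarrow> real" where
  "C_trial P S lam m =
     2 * (smooth_part P (y_trial P S lam m) - lin_f P (y_trial P S lam m) (x_tilde S))
       / (norm (y_trial P S lam m - x_tilde S))\<^sup>2"

definition cond_i :: "'a::real_inner problem \<Rightarrow> 'a fista_state \<Rightarrow> real \<Rightarrow> real \<Rightarrow> bool" where
  "cond_i P S lam m \<longleftrightarrow> lam * C_trial P S lam m \<le> 9/10"

definition cond_ii :: "'a::real_inner problem \<Rightarrow> 'a \<Rightarrow> 'a fista_state \<Rightarrow> real \<Rightarrow> real \<Rightarrow> bool" where
  "cond_ii P y\<^sub>0 S lam m \<longleftrightarrow> 2 * m * (st_lam S - lam / coef_a S) \<ge> m_lower P y\<^sub>0 S * lam"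

fun sub_accepts :: "'a::real_inner problem \<Rightarrow> 'a \<Rightarrow> 'a fista_state \<Rightarrow> real \<times> real \<Rightarrow> bool" where
  "sub_accepts P y\<^sub>0 S (lam, m) \<longleftrightarrow> cond_i P S lam m \<and> cond_ii P y\<^sub>0 S lam m"

fun sub_update ::
  "'a::real_inner problem \<Rightarrow> real \<Rightarrow> 'a \<Rightarrow> 'a fista_state \<Rightarrow> real \<times> real \<Rightarrow> real \<times> real" where
  "sub_update P \<theta> y\<^sub>0 S (lam, m) =
     (if cond_i P S lam m then lam else min (lam / \<theta>) ((9/10) / C_trial P S lam m),
      if cond_ii P y\<^sub>0 S lam m then m else 2 * m)"

text \<open>The pair examined in pass number \<open>j\<close> of SUB, the passes being counted from 0.\<close>

definition sub_pair ::
  "'a::real_inner problem \<Rightarrow> real \<Rightarrow> 'a \<Rightarrow> 'a fista_state \<Rightarrow> nat \<Rightarrow> real \<times> real" where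
  "sub_pair P \<theta> y\<^sub>0 S j = (sub_update P \<theta> y\<^sub>0 S ^^ j) (st_lam S, st_m S)"

definition sub_terminates :: "'a::real_inner problem \<Rightarrow> real \<Rightarrow> 'a \<Rightarrow> 'a fista_state \<Rightarrow> bool" where
  "sub_terminates P \<theta> y\<^sub>0 S \<longleftrightarrow> (\<exists>j. sub_accepts P y\<^sub>0 S (sub_pair P \<theta> y\<^sub>0 S j))"

definition sub_last :: "'a::real_inner problem \<Rightarrow> real \<Rightarrow> 'a \<Rightarrow> 'a fista_state \<Rightarrow> nat" where
  "sub_last P \<theta> y\<^sub>0 S = (LEAST j. sub_accepts P y\<^sub>0 S (sub_pair P \<theta> y\<^sub>0 S j))"

text \<open>
  The number of passes, including the accepting one.  Each pass evaluates \<open>y_trial\<close> once, that is,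
  it performs one resolvent evaluation of \<open>h\<close>.
\<close>

definition sub_passes :: "'a::real_inner problem \<Rightarrow> real \<Rightarrow> 'a \<Rightarrow> 'a fista_state \<Rightarrow> nat" where
  "sub_passes P \<theta> y\<^sub>0 S = Suc (sub_last P \<theta> y\<^sub>0 S)"

definition fista_step ::
  "'a::real_inner problem \<Rightarrow> real \<Rightarrow> 'a \<Rightarrow> 'a fista_state \<Rightarrow> 'a fista_state" where
  "fista_step P \<theta> y\<^sub>0 S =
     (let (lam, m) = sub_pair P \<theta> y\<^sub>0 S (sub_last P \<theta> y\<^sub>0 S);
          a = coef_a S;
          y' = y_trial P S lam m
      in \<lparr> st_y = y',
           st_x = proj_region P
             ((1 / (2 * m * lam + 1)) *\<^sub>R ((a + 2 * m * lam) *\<^sub>R y' - (a - 1) *\<^sub>R st_y S)),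
           st_A = A_next S,
           st_lam = lam,
           st_m = m,
           st_v = (1 / lam + 2 * m / a) *\<^sub>R (x_tilde S - y') + grad P y' - grad P (x_tilde S) \<rparr>)"

definition fista_init :: "'a::real_inner \<Rightarrow> real \<Rightarrow> real \<Rightarrow> 'a fista_state" where
  "fista_init y\<^sub>0 M\<^sub>0 m\<^sub>0 =
     \<lparr> st_y = y\<^sub>0, st_x = y\<^sub>0, st_A = 2, st_lam = 1 / M\<^sub>0, st_m = m\<^sub>0, st_v = 0 \<rparr>"

definition fista ::
  "'a::real_inner problem \<Rightarrow> real \<Rightarrow> 'a \<Rightarrow> real \<Rightarrow> real \<Rightarrow> nat \<Rightarrow> 'a fista_state" where
  "fista P \<theta> y\<^sub>0 M\<^sub>0 m\<^sub>0 k = (fista_step P \<theta> y\<^sub>0 ^^ k) (fista_init y\<^sub>0 M\<^sub>0 m\<^sub>0)"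

text \<open>
  The algorithm stops after exactly \<open>T\<close> outer iterations (those with \<open>k = 0, \<dots>, T - 1\<close>), with output
  \<open>(y\<^sub>T, v\<^sub>T)\<close>; in particular, each of its calls of SUB returns.
\<close>

definition fista_stops ::
  "'a::real_inner problem \<Rightarrow> real \<Rightarrow> 'a \<Rightarrow> real \<Rightarrow> real \<Rightarrow> real \<Rightarrow> nat \<Rightarrow> bool" where
  "fista_stops P \<theta> y\<^sub>0 M\<^sub>0 m\<^sub>0 \<rho> T \<longleftrightarrow>
     T \<ge> 1 \<and>
     (\<forall>k<T. sub_terminates P \<theta> y\<^sub>0 (fista P \<theta> y\<^sub>0 M\<^sub>0 m\<^sub>0 k)) \<and>
     (\<forall>k\<in>{1..<T}. norm (st_v (fista P \<theta> y\<^sub>0 M\<^sub>0 m\<^sub>0 k)) > \<rho>) \<and>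
     norm (st_v (fista P \<theta> y\<^sub>0 M\<^sub>0 m\<^sub>0 T)) \<le> \<rho>"

definition C_2 :: "'a::real_inner problem \<Rightarrow> real \<Rightarrow> real" where
  "C_2 P M\<^sub>0 = (sqrt (M\<^sub>0 / M_bar P) + sqrt (M_bar P / M\<^sub>0))\<^sup>2"

definition C_1 :: "'a::real_inner problem \<Rightarrow> real \<Rightarrow> real \<Rightarrow> real" where
  "C_1 P M\<^sub>0 m\<^sub>0 = C_2 P M\<^sub>0 * max (m_bar P / m\<^sub>0) 1"

definition log1_plus :: "real \<Rightarrow> real" where
  "log1_plus s = max (ln s) 1"

end

theory Submission
  imports Defs
begin

text \<open>
  Fix a reference point \<open>u\<close> and put
  \<open>E\<^sub>k = (\<lambda>\<^sub>k / m\<^sub>k) A\<^sub>k (\<phi>(y\<^sub>k) - \<phi>\<^sub>*) + (\<lambda>\<^sub>k + 1 / (2 m\<^sub>k)) \<parallel>u - x\<^sub>k\<parallel>\<^sup>2\<close>.  Adding the prox inequalities at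
  \<open>y\<^sub>k\<close> and at \<open>u\<close> with weights \<open>A\<^sub>k\<close> and \<open>a\<^sub>k\<close>, and using condition (ii) to absorb the nonconvexity of
  \<open>f\<close> between \<open>x_tilde\<close> and \<open>y_tilde\<close>, shows that \<open>E\<^sub>k\<close> decreases by a multiple of
  \<open>A\<^sub>k\<^sub>+\<^sub>1 \<parallel>y\<^sub>k\<^sub>+\<^sub>1 - x_tilde\<parallel>\<^sup>2 / m\<^sub>k\<^sub>+\<^sub>1\<close>, up to an error linear in \<open>a\<^sub>k\<close>.  The division by \<open>m\<^sub>k\<close> is what makes
  the sum telescope although \<open>m\<^sub>k\<close> increases and \<open>x\<^sub>k\<close> need not stay bounded.  Since \<open>\<parallel>v\<^sub>k\<^sub>+\<^sub>1\<parallel>\<close> is at most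
  a multiple of \<open>\<parallel>y\<^sub>k\<^sub>+\<^sub>1 - x_tilde\<parallel>\<close> and \<open>A\<^sub>k\<close> grows quadratically, summation bounds \<open>k\<^sup>3 \<rho>\<^sup>2\<close> by a quadratic
  polynomial in \<open>k\<close>.  Part (a) takes \<open>u = y\<^sub>0\<close>; part (b) takes \<open>u\<close> optimal, for which the part of the
  error coming from \<open>\<phi>(u)\<close> vanishes.  For (c), every rejected pass of SUB divides \<open>\<lambda>\<close> by at least \<open>\<theta>\<close>
  or doubles \<open>m\<close>, which is possible only while \<open>\<lambda> M_bar > 9/10\<close>, respectively \<open>m < m_bar\<close>.
\<close>


section \<open>Finite-dimensional subspaces of an inner product space\<close>

text \<open>Both sides are linear in \<open>x\<close>, so only \<open>x\<close> in \<open>C\<close>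
  matters, where orthogonality leaves a single term. A zero vector in \<open>C\<close> is harmless,
  since its term is 0.\<close>

lemma orthogonal_expansion:
  fixes C :: "'a::real_inner set"
  assumes "finite C" "pairwise orthogonal C" "x \<in> span C"
  shows "x = (\<Sum>c\<in>C. ((x \<bullet> c) / (c \<bullet> c)) *\<^sub>R c)"
  using assms(3)
proof (induction rule: span_induct_alt)
  case base
  then show ?case by simp
next
  case (step t b x)
  have "(\<Sum>c\<in>C. ((b \<bullet> c) / (c \<bullet> c)) *\<^sub>R c) = (\<Sum>c\<in>C. if c = b then b else 0)"
    using assms(2) step.hyps
    by (intro sum.cong) (auto simp: pairwise_def orthogonal_def)
  then have "(\<Sum>c\<in>C. ((b \<bullet> c) / (c \<bullet> c)) *\<^sub>R c) = b"
    using assms(1) step.hyps by simp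
  then have "t *\<^sub>R (\<Sum>c\<in>C. ((b \<bullet> c) / (c \<bullet> c)) *\<^sub>R c) = t *\<^sub>R b" by simp
  then show ?case
    using step.IH
    by (simp add: inner_add_left add_divide_distrib scaleR_add_left sum.distrib scaleR_sum_right)
qed

text \<open>Adding one vector at a time presents the set as a continuous image of the product of an
  interval with a smaller set of the same kind.\<close>

lemma compact_coefficient_box:
  fixes C :: "'a::real_normed_vector set"
  assumes "finite C"
  shows "compact {\<Sum>c\<in>C. q c *\<^sub>R c | q. \<forall>c\<in>C. \<bar>q c\<bar> \<le> R}"
  using assms
proof (induction C rule: finite_induct)
  case empty
  then show ?case by simp
next
  case (insert b C)
  let ?K = "{\<Sum>c\<in>C. q c *\<^sub>R c | q. \<forall>c\<in>C. \<bar>q c\<bar> \<le> R}"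
  have "{\<Sum>c\<in>insert b C. q c *\<^sub>R c | q. \<forall>c\<in>insert b C. \<bar>q c\<bar> \<le> R}
      = (\<lambda>(t, x). t *\<^sub>R b + x) ` ({-R..R} \<times> ?K)" (is "?L = ?I")
  proof
    show "?L \<subseteq> ?I"
      using insert.hyps by (fastforce simp: abs_le_iff)
    show "?I \<subseteq> ?L"
    proof
      fix z assume "z \<in> ?I"
      then obtain t q where *: "z = t *\<^sub>R b + (\<Sum>c\<in>C. q c *\<^sub>R c)" "\<bar>t\<bar> \<le> R" "\<forall>c\<in>C. \<bar>q c\<bar> \<le> R"
        by auto
      have "(\<Sum>c\<in>C. (q(b := t)) c *\<^sub>R c) = (\<Sum>c\<in>C. q c *\<^sub>R c)"
        using insert.hyps by (intro sum.cong) auto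
      then have "z = (\<Sum>c\<in>insert b C. (q(b := t)) c *\<^sub>R c)"
        using insert.hyps * by simp
      then show "z \<in> ?L"
        using * by (intro CollectI exI[of _ "q(b := t)"]) auto
    qed
  qed
  moreover have "compact ((\<lambda>(t, x). t *\<^sub>R b + x) ` ({-R..R} \<times> ?K))"
    by (intro compact_continuous_image compact_Times insert.IH)
       (auto simp: case_prod_unfold intro!: continuous_intros)
  ultimately show ?case by simp
qed

text \<open>Heine-Borel for a finitely spanned part of a possibly infinite-dimensional space: by
  Cauchy-Schwarz the coefficients of a bounded set in an orthogonal family are bounded, so
  \<open>S\<close> is a closed part of a compact set.\<close>

lemma compact_closed_bounded_in_span:
  fixes S :: "'a::real_inner set"
  assumes "finite B" "S \<subseteq> span B" "bounded S" "closed S"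
  shows "compact S"
proof -
  obtain C where C: "finite C" "span C = span B" "pairwise orthogonal C"
    using basis_orthogonal[OF assms(1)] by blast
  obtain r where r: "\<And>x. x \<in> S \<Longrightarrow> norm x \<le> r" "r > 0"
    using assms(3) unfolding bounded_pos by blast
  \<comment> \<open>A sum of nonnegative quotients bounds each of them and, unlike a maximum, is
    also defined for empty \<open>C\<close>.\<close>
  define R where "R = (\<Sum>c\<in>C. r / norm c)"
  have K: "S \<subseteq> {\<Sum>c\<in>C. q c *\<^sub>R c | q. \<forall>c\<in>C. \<bar>q c\<bar> \<le> R}"
  proof
    fix x assume x: "x \<in> S"
    have "\<bar>(x \<bullet> c) / (c \<bullet> c)\<bar> \<le> R" if c: "c \<in> C" for c
    proof -
      have "\<bar>(x \<bullet> c) / (c \<bullet> c)\<bar> = \<bar>x \<bullet> c\<bar> / (norm c)\<^sup>2"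
        by (simp add: dot_square_norm)
      also have "\<dots> \<le> (norm x * norm c) / (norm c)\<^sup>2"
        by (intro divide_right_mono Cauchy_Schwarz_ineq2) simp
      also have "\<dots> = norm x / norm c"
        by (simp add: power2_eq_square)
      also have "\<dots> \<le> r / norm c"
        by (intro divide_right_mono r(1) x) simp
      also have "\<dots> \<le> R"
        unfolding R_def using r(2) by (intro member_le_sum c C(1)) simp
      finally show ?thesis .
    qed
    then show "x \<in> {\<Sum>c\<in>C. q c *\<^sub>R c | q. \<forall>c\<in>C. \<bar>q c\<bar> \<le> R}"
      using orthogonal_expansion[OF C(1,3), of x] x assms(2) C(2)
      by (intro CollectI exI[of _ "\<lambda>c. (x \<bullet> c) / (c \<bullet> c)"] conjI ballI) blast+
  qed
  show ?thesis
    using compact_Int_closed[OF compact_coefficient_box[OF C(1), of R] assms(4)]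
    unfolding Int_absorb1[OF K] .
qed

text \<open>The span is the set where the identity agrees with the orthogonal expansion, and both
  maps are continuous.\<close>

lemma closed_finite_span:
  fixes B :: "'a::real_inner set"
  assumes "finite B"
  shows "closed (span B)"
proof -
  obtain C where C: "finite C" "span C = span B" "pairwise orthogonal C"
    using basis_orthogonal[OF assms(1)] by blast
  have "span B = {x. x = (\<Sum>c\<in>C. ((x \<bullet> c) / (c \<bullet> c)) *\<^sub>R c)}"
    using orthogonal_expansion[OF C(1,3)] C(2)
    by (auto simp: ) (metis (no_types, lifting) span_sum span_scale span_base)
  \<comment> \<open>Division by \<open>c \<bullet> c\<close>, which may be 0, is rewritten as
    multiplication by a constant, so that continuity has no side condition.\<close>
  moreover have "closed {x. x = (\<Sum>c\<in>C. ((x \<bullet> c) / (c \<bullet> c)) *\<^sub>R c)}"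
    unfolding divide_inverse by (intro closed_Collect_eq continuous_intros)
  ultimately show ?thesis by simp
qed

text \<open>The values of \<open>D\<close> on an orthogonal spanning family determine
  \<open>g\<close> explicitly. This turns an abstract derivative into a gradient vector.\<close>

lemma riesz_finite_span:
  fixes D :: "'a::real_inner \<Rightarrow> real"
  assumes "finite B" "linear D"
  obtains g where "g \<in> span B" "\<And>x. x \<in> span B \<Longrightarrow> D x = g \<bullet> x"
proof -
  obtain C where C: "finite C" "span C = span B" "pairwise orthogonal C"
    using basis_orthogonal[OF assms(1)] by blast
  let ?g = "\<Sum>c\<in>C. (D c / (c \<bullet> c)) *\<^sub>R c"
  have "D x = ?g \<bullet> x" if "x \<in> span B" for x
  proof -
    have "D x = D (\<Sum>c\<in>C. ((x \<bullet> c) / (c \<bullet> c)) *\<^sub>R c)"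
      using orthogonal_expansion[OF C(1,3)] C(2) that by metis
    also have "\<dots> = ?g \<bullet> x"
      unfolding linear_sum[OF assms(2)] linear_scale[OF assms(2)] inner_sum_left inner_scaleR_left
      by (intro sum.cong) (simp_all add: inner_commute[of x])
    finally show ?thesis .
  qed
  moreover have "?g \<in> span B"
    using C(2) by (metis (no_types, lifting) span_sum span_scale span_base)
  ultimately show thesis using that by blast
qed


section \<open>Projection, prox and acceleration inequalities\<close>

text \<open>If the inner product were positive, a small move from \<open>x\<close> towards
  \<open>y\<close> would stay in \<open>S\<close> and come closer to \<open>a\<close>.\<close>

lemma closest_point_variational:
  fixes a :: "'a::real_inner"
  assumes "convex S" "x \<in> S" "y \<in> S" "\<And>z. z \<in> S \<Longrightarrow> norm (x - a) \<le> norm (z - a)"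
  shows "(a - x) \<bullet> (y - x) \<le> 0"
proof (rule ccontr)
  assume n: "\<not> ?thesis"
  then obtain u where u: "u > 0" "u \<le> 1" "dist (x + u *\<^sub>R (y - x)) a < dist x a"
    using closer_point_lemma[of a x y] by auto
  have "x + u *\<^sub>R (y - x) = (1 - u) *\<^sub>R x + u *\<^sub>R y" by (simp add: algebra_simps)
  then have "x + u *\<^sub>R (y - x) \<in> S"
    using convexD_alt[OF assms(1,2,3), of u] u by auto
  then show False using assms(4) u(3) by (fastforce simp: dist_norm)
qed

text \<open>\<open>hr\<close> is real valued; the value \<open>\<infinity>\<close> is encoded by leaving the set \<open>S\<close>.\<close>

lemma prox_inequality:
  fixes w :: "'a::real_inner" and hr :: "'a \<Rightarrow> real"
  assumes "convex_on S hr" "y \<in> S" "u \<in> S"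
    and min: "\<And>z. z \<in> S \<Longrightarrow> g \<bullet> y + hr y + s / 2 * (norm (y - w))\<^sup>2
                            \<le> g \<bullet> z + hr z + s / 2 * (norm (z - w))\<^sup>2"
  shows "hr y + (s *\<^sub>R (w - y) - g) \<bullet> (u - y) \<le> hr u"
proof -
  have S: "convex S" using assms(1) convex_on_imp_convex by blast
  \<comment> \<open>The minimizer is compared with a point \<open>z\<close> of the segment towards
    \<open>u\<close>. After division by \<open>t\<close>, only the square of
    \<open>norm (u - y)\<close> still carries a factor \<open>t\<close>, so the limit at 0 gives the
    claim.\<close>
  have *: "hr y + (s *\<^sub>R (w - y) - g) \<bullet> (u - y) - hr u \<le> t * (s / 2 * (norm (u - y))\<^sup>2)"
    if t: "0 < t" "t < 1" for t
  proof -
    define z where "z = (1 - t) *\<^sub>R y + t *\<^sub>R u"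
    have "z \<in> S" unfolding z_def using convexD_alt[OF S assms(2,3)] t by simp
    have "hr z \<le> (1 - t) * hr y + t * hr u"
      unfolding z_def using convex_onD[OF assms(1), of t y u] t assms(2,3) by simp
    then have "t * (hr y - hr u) \<le> g \<bullet> z - g \<bullet> y
      + s / 2 * ((norm (z - w))\<^sup>2 - (norm (y - w))\<^sup>2)"
      using min[OF \<open>z \<in> S\<close>] by (simp add: algebra_simps)
    also have "g \<bullet> z - g \<bullet> y = t * (g \<bullet> (u - y))"
      by (simp add: z_def algebra_simps)
    also have "(norm (z - w))\<^sup>2 - (norm (y - w))\<^sup>2
        = t * (t * (norm (u - y))\<^sup>2 - 2 * ((w - y) \<bullet> (u - y)))"
    proof -
      have z: "z - w = t *\<^sub>R (u - y) - (w - y)" by (simp add: z_def algebra_simps)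
      show ?thesis
        unfolding z norm_minus_commute[of y w] power2_norm_eq_inner
        by (simp only: inner_diff_left[of "t *\<^sub>R (u - y)"] inner_diff_right[of _ "t *\<^sub>R (u - y)"]
            inner_scaleR_left inner_scaleR_right inner_commute[of "u - y" "w - y"])
           (simp add: algebra_simps)
    qed
    finally have "t * (hr y - hr u)
       \<le> t * (g \<bullet> (u - y) + s / 2 * (t * (norm (u - y))\<^sup>2 - 2 * ((w - y) \<bullet> (u - y))))"
      by (simp add: algebra_simps)
    then have "hr y - hr u \<le> g \<bullet> (u - y) + s / 2 * (t * (norm (u - y))\<^sup>2 - 2 * ((w - y) \<bullet> (u - y)))"
      using t(1) by simp
    then show ?thesis by (simp add: inner_diff_left algebra_simps)
  qed
  have "((\<lambda>t. t * (s / 2 * (norm (u - y))\<^sup>2)) \<longlongrightarrow> 0 * (s / 2 * (norm (u - y))\<^sup>2)) (at_right 0)"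
    by (intro tendsto_intros)
  moreover have "eventually (\<lambda>t. hr y + (s *\<^sub>R (w - y) - g) \<bullet> (u - y) - hr u
      \<le> t * (s / 2 * (norm (u - y))\<^sup>2)) (at_right 0)"
    unfolding eventually_at_right_field by (intro exI[of _ 1] conjI allI impI *) auto
  ultimately have "hr y + (s *\<^sub>R (w - y) - g) \<bullet> (u - y) - hr u \<le> 0 * (s / 2 * (norm (u - y))\<^sup>2)"
    by (rule tendsto_lowerbound) simp
  then show ?thesis by simp
qed

text \<open>
  The points are translated so that the new iterate \<open>y\<^sub>k\<^sub>+\<^sub>1\<close> is the origin: \<open>Y, X, Z\<close> stand for
  \<open>y\<^sub>k, x\<^sub>k, x\<^sub>k\<^sub>+\<^sub>1\<close>, while \<open>T\<close> is \<open>x_tilde\<close> and \<open>s = 2 m \<lambda>\<close>.  With equality in \<open>vi\<close>, and up to the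
  discarded squares, the inequality is an identity.
\<close>

lemma accelerated_step_vector_inequality:
  fixes T X Y Z U :: "'a::real_inner"
  assumes a: "a \<ge> 1" and s: "s \<ge> 0"
    and T: "a *\<^sub>R T = (a - 1) *\<^sub>R Y + X"
    and vi: "(- (a - 1) *\<^sub>R Y - (1 + s) *\<^sub>R Z) \<bullet> (U - Z) \<le> 0"
  shows "a\<^sup>2 * (norm T)\<^sup>2 + (1 + s) * (norm (U - Z))\<^sup>2
           - (1 + s / a) * (norm (U - X))\<^sup>2 - s * (a - 1) / a * (norm (Y - U))\<^sup>2
         \<le> 2 * (1 + s / a) * (T \<bullet> (a *\<^sub>R ((a - 1) *\<^sub>R Y + U)))"
proof -
  define b where "b = a - 1"
  have ab: "a = b + 1" "b \<ge> 0" using a by (auto simp: b_def)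
  have T': "a *\<^sub>R T = b *\<^sub>R Y + X" using T by (simp add: b_def)
  \<comment> \<open>From here on only these nine scalar products occur, and the claim becomes
    polynomial arithmetic.\<close>
  define yy where "yy = Y \<bullet> Y"  define xx where "xx = X \<bullet> X"  define zz where "zz = Z \<bullet> Z"
  define uu where "uu = U \<bullet> U"  define yx where "yx = Y \<bullet> X"  define yz where "yz = Y \<bullet> Z"
  define yu where "yu = Y \<bullet> U"  define xu where "xu = X \<bullet> U"  define zu where "zu = Z \<bullet> U"
  note d = yy_def xx_def zz_def uu_def yx_def yz_def yu_def xu_def zu_def
  have nT: "a\<^sup>2 * (norm T)\<^sup>2 = b\<^sup>2 * yy + xx + 2 * b * yx"
  proof -
    have "a\<^sup>2 * (norm T)\<^sup>2 = (a *\<^sub>R T) \<bullet> (a *\<^sub>R T)"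
      by (simp add: power_mult_distrib flip: power2_norm_eq_inner)
    also have "\<dots> = b\<^sup>2 * yy + xx + 2 * b * yx"
      unfolding T' d inner_add_left inner_add_right inner_scaleR_left inner_scaleR_right
      by (simp add: inner_commute[of X Y] power2_eq_square algebra_simps)
    finally show ?thesis .
  qed
  have nT2: "T \<bullet> (a *\<^sub>R (b *\<^sub>R Y + U)) = b\<^sup>2 * yy + b * yu + b * yx + xu"
  proof -
    have "T \<bullet> (a *\<^sub>R (b *\<^sub>R Y + U)) = (a *\<^sub>R T) \<bullet> (b *\<^sub>R Y + U)" by simp
    also have "\<dots> = b\<^sup>2 * yy + b * yu + b * yx + xu"
      unfolding T' d inner_add_left inner_add_right inner_scaleR_left inner_scaleR_right
      by (simp add: inner_commute[of X Y] power2_eq_square algebra_simps)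
    finally show ?thesis .
  qed
  have nUZ: "(norm (U - Z))\<^sup>2 = uu + zz - 2 * zu" and nUX: "(norm (U - X))\<^sup>2 = uu + xx - 2 * xu"
    and nYU: "(norm (Y - U))\<^sup>2 = yy + uu - 2 * yu"
    unfolding d by (simp_all add: power2_norm_eq_inner inner_commute algebra_simps)
  have vi': "- b * yu + b * yz - (1 + s) * zu + (1 + s) * zz \<le> 0"
    using vi unfolding d b_def[symmetric]
    by (simp add: inner_commute algebra_simps)
  have sq1: "0 \<le> zz + 2 * b * yz + b\<^sup>2 * yy"
  proof -
    have "0 \<le> (norm (Z + b *\<^sub>R Y))\<^sup>2" by simp
    also have "\<dots> = zz + 2 * b * yz + b\<^sup>2 * yy"
      unfolding d power2_norm_eq_inner inner_add_left inner_add_right inner_scaleR_left inner_scaleR_right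
      by (simp add: inner_commute[of Z Y] power2_eq_square algebra_simps)
    finally show ?thesis .
  qed
  have sq2: "0 \<le> b\<^sup>2 * yy + xx + 2 * b * yx"
    using nT by (metis mult_nonneg_nonneg zero_le_power2)
  have pos: "0 \<le> yy" "0 \<le> zz" unfolding d by simp_all
  have sq3: "0 \<le> s * zz" using pos s by simp
  \<comment> \<open>This eliminates \<open>Z\<close>. Together with \<open>nT\<close> and the
    distance from \<open>U\<close> to \<open>X\<close> it reproduces the right-hand side up to the
    term \<open>s * uu\<close>, which the next estimate absorbs along with everything that carries
    the factor \<open>s / a\<close>.\<close>
  have *: "(1 + s) * (uu + zz - 2 * zu) \<le> (1 + s) * uu + b\<^sup>2 * yy + 2 * b * yu"
    using vi' sq1 sq3 by (simp add: algebra_simps)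
  have sa: "0 \<le> s / a" using s a by simp
  have **: "s / a * (a * uu)
      - s / a * (uu + xx - 2 * xu) - s * b / a * (yy + uu - 2 * yu)
      \<le> 2 * (s / a) * (b\<^sup>2 * yy + b * yu + b * yx + xu)"
  proof -
    have "s / a * (a * uu - (uu + xx - 2 * xu) - b * (yy + uu - 2 * yu))
       \<le> s / a * (2 * (b\<^sup>2 * yy + b * yu + b * yx + xu))"
    proof (rule mult_left_mono[OF _ sa])
      have "0 \<le> b\<^sup>2 * yy + b * yy" using pos ab by simp
      then show "a * uu - (uu + xx - 2 * xu) - b * (yy + uu - 2 * yu)
         \<le> 2 * (b\<^sup>2 * yy + b * yu + b * yx + xu)"
        using sq2 unfolding ab(1) by (simp add: algebra_simps)
    qed
    moreover have "s * b / a = s / a * b" by simp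
    ultimately show ?thesis by (simp add: right_diff_distrib mult.assoc mult.left_commute)
  qed
  show ?thesis
    unfolding nT b_def[symmetric] nT2 nUZ nUX nYU
    using * ** a by (simp add: algebra_simps)
qed

text \<open>The direct method: a minimizing sequence in the bounded domain has a subsequence
  converging in the compact closure, and lower semicontinuity bounds the value at the limit.
  Continuity of \<open>q\<close> is asked on the closure because the limit is not known in advance
  to lie in the domain.\<close>

lemma liminf_lsc_attains_min:
  fixes h :: "'a::real_inner \<Rightarrow> ereal" and q :: "'a \<Rightarrow> real"
  assumes B: "finite B"
    and lsc: "\<And>z. z \<in> span B \<Longrightarrow> h z \<le> Liminf (at z within span B) h"
    and dom: "bounded {z \<in> span B. h z < \<infinity>}" "{z \<in> span B. h z < \<infinity>} \<noteq> {}"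
    and q: "continuous_on (closure {z \<in> span B. h z < \<infinity>}) q"
  obtains z where "z \<in> span B" "\<And>u. u \<in> span B \<Longrightarrow> h z + ereal (q z) \<le> h u + ereal (q u)"
proof -
  define D where "D = {z \<in> span B. h z < \<infinity>}"
  define F where "F = (\<lambda>u. h u + ereal (q u))"
  have "F ` D \<noteq> {}" using dom(2) unfolding D_def by simp
  from Inf_as_limit[OF this]
  obtain v where v: "\<forall>n. v n \<in> F ` D" "v \<longlonglongrightarrow> Inf (F ` D)" by (elim exE conjE) (rule that)
  define u where "u n = (SOME x. x \<in> D \<and> v n = F x)" for n
  have "u n \<in> D \<and> v n = F (u n)" for n
    unfolding u_def by (rule someI_ex) (use v(1) in \<open>simp add: image_iff Bex_def\<close>)
  then have u: "\<And>n. u n \<in> D" "\<And>n. F (u n) = v n" by simp_all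
  have "D \<subseteq> closure D" by (rule closure_subset)
  have "closure D \<subseteq> span B"
    by (rule closure_minimal[OF _ closed_finite_span[OF B]]) (auto simp: D_def)
  have "bounded (closure D)" using dom(1) unfolding D_def by (rule bounded_closure)
  then have cD: "compact (closure D)"
    by (intro compact_closed_bounded_in_span[OF B] \<open>closure D \<subseteq> span B\<close> closed_closure)
  have uD: "\<forall>n. u n \<in> closure D" using u(1) \<open>D \<subseteq> closure D\<close> by (auto dest: subsetD)
  obtain l r where l: "l \<in> closure D" "strict_mono (r :: nat \<Rightarrow> nat)" "(u \<circ> r) \<longlonglongrightarrow> l"
    using cD[unfolded compact_def, THEN spec, THEN mp, OF uD] by auto
  have lB: "l \<in> span B" using l(1) \<open>closure D \<subseteq> span B\<close> by blast
  have uB: "(u \<circ> r) n \<in> span B" for n using u(1)[of "r n"] unfolding D_def by simp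
  have ql: "(\<lambda>n. q ((u \<circ> r) n)) \<longlonglongrightarrow> q l"
    using continuous_on_tendsto_compose[OF q l(3)] l(1) uD unfolding D_def by simp
  have vr: "(\<lambda>n. F ((u \<circ> r) n)) \<longlonglongrightarrow> Inf (F ` D)"
    using LIMSEQ_subseq_LIMSEQ[OF v(2) l(2)] u(2) by (simp add: comp_def)
  have Fl: "F l \<le> Inf (F ` D)"
  proof (rule ccontr)
    assume "\<not> ?thesis"
    then obtain c where c: "Inf (F ` D) < ereal c" "ereal c < F l"
      using ereal_dense2[of "Inf (F ` D)" "F l"] by (auto simp: not_le)
    \<comment> \<open>The real \<open>c\<close> separates the infimum from \<open>F l\<close>. It is
      split into a lower bound \<open>e\<close> for \<open>h\<close> and \<open>c - e\<close> for
      \<open>q\<close>, which together keep \<open>F\<close> above \<open>c\<close> along the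
      subsequence.\<close>
    have "ereal (c - q l) < h l"
      using c(2) unfolding F_def by (cases "h l") auto
    then obtain e where e: "c - q l < e" "ereal e < h l"
      using ereal_dense2[of "ereal (c - q l)" "h l"] by auto
    have "eventually (\<lambda>z. ereal e < h z) (at l within span B)"
      by (rule less_LiminfD[OF less_le_trans[OF e(2) lsc[OF lB]]])
    \<comment> \<open>\<open>Liminf\<close> ignores the point \<open>l\<close> itself. There the
      bound is \<open>e < h l\<close>, so the subsequence may also hit \<open>l\<close>.\<close>
    then have ev: "eventually (\<lambda>z. z \<in> span B \<longrightarrow> ereal e < h z) (nhds l)"
      unfolding eventually_at_filter using e(2) by (auto elim!: eventually_mono)
    have "eventually (\<lambda>n. ereal e < h ((u \<circ> r) n)) sequentially"
      using eventually_compose_filterlim[OF ev l(3)] uB by simp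
    moreover have "eventually (\<lambda>n. c - e < q ((u \<circ> r) n)) sequentially"
      using order_tendstoD(1)[OF ql, of "c - e"] e(1) by simp
    moreover have "eventually (\<lambda>n. F ((u \<circ> r) n) < ereal c) sequentially"
      using order_tendstoD(2)[OF vr c(1)] .
    ultimately have "eventually (\<lambda>n. False) sequentially"
    proof eventually_elim
      case (elim n)
      then have "ereal c < F ((u \<circ> r) n)"
        unfolding F_def by (cases "h ((u \<circ> r) n)") auto
      then show ?case using elim(3) by simp
    qed
    then show False by simp
  qed
  have "F l \<le> F z" if "z \<in> span B" for z
  proof (cases "z \<in> D")
    case True
    then show ?thesis using Fl by (meson INF_lower order_trans)
  next
    case False
    then show ?thesis using that unfolding D_def F_def by simp
  qed
  then show thesis using that[OF lB] unfolding F_def by blast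
qed


section \<open>Curvature constants of the composite problem\<close>

lemma le_mult_if_le_perturbed:
  fixes M r x :: real
  assumes "r \<ge> 0" "\<And>e. e > 0 \<Longrightarrow> x \<le> (M + e) * r"
  shows "x \<le> M * r"
proof (rule field_le_epsilon)
  fix e :: real assume e: "e > 0"
  \<comment> \<open>The denominator \<open>r + 1\<close> covers \<open>r = 0\<close> as
    well.\<close>
  have "x \<le> (M + e / (r + 1)) * r" using e assms(1) by (intro assms(2)) simp
  also have "\<dots> = M * r + e * (r / (r + 1))" using assms(1) by (simp add: algebra_simps)
  also have "\<dots> \<le> M * r + e"
    using e assms(1) mult_left_mono[of "r / (r + 1)" 1 e] by simp
  finally show "x \<le> M * r + e" .
qed

text \<open>\<open>LEAST\<close> over the reals is informative only if the infimum is attained.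
  Upward closure and closure under limits from the right give attainment, and failure at 0 makes the
  infimum positive.\<close>

lemma least_positive_attained:
  fixes Q :: "real \<Rightarrow> bool"
  assumes ex: "\<exists>M>0. Q M" and z: "\<not> Q 0"
    and up: "\<And>M M'. Q M \<Longrightarrow> M \<le> M' \<Longrightarrow> Q M'"
    and lim: "\<And>M. (\<And>e. e > 0 \<Longrightarrow> Q (M + e)) \<Longrightarrow> Q M"
  shows "0 < (LEAST M. 0 < M \<and> Q M) \<and> Q (LEAST M. 0 < M \<and> Q M)
    \<and> (\<forall>M. 0 < M \<and> Q M \<longrightarrow> (LEAST M. 0 < M \<and> Q M) \<le> M)"
proof -
  define S where "S = {M. 0 < M \<and> Q M}"
  have S: "S \<noteq> {}" "bdd_below S" using ex unfolding S_def by (auto intro: bdd_belowI[of _ 0])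
  have "Q (Inf S)"
  proof (rule lim)
    fix e :: real assume "e > 0"
    then have "Inf S < Inf S + e" by simp
    then obtain M where "M \<in> S" "M < Inf S + e" using cInf_lessD[OF S(1)] by blast
    then show "Q (Inf S + e)" using up[of M "Inf S + e"] unfolding S_def by simp
  qed
  moreover have "0 \<le> Inf S" using S(1) by (rule cInf_greatest) (simp add: S_def)
  ultimately have *: "0 < Inf S \<and> Q (Inf S)" using z by (cases "Inf S = 0") auto
  have **: "Inf S \<le> M" if "0 < M \<and> Q M" for M
    using that by (intro cInf_lower S(2)) (simp add: S_def)
  have "(LEAST M. 0 < M \<and> Q M) = Inf S"
    by (rule Least_equality) (use * ** in blast)+
  then show ?thesis using * ** by simp
qed

section \<open>Real-valued form of the problem, its gradient and its curvature\<close>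

locale composite =
  fixes P :: "'a::real_inner problem"
  assumes composite: "composite_problem P"
begin

abbreviation "E \<equiv> ambient P"
abbreviation "f \<equiv> smooth_part P"
abbreviation "h \<equiv> nonsmooth_part P"
abbreviation "\<Omega> \<equiv> feasible_region P"
abbreviation "D \<equiv> dom_h P"

text \<open>Meaningful on \<open>D\<close> only: at points of \<open>E\<close> outside of it the
  value \<infinity> is converted to 0.\<close>

definition hr :: "'a \<Rightarrow> real" where "hr z = real_of_ereal (h z)"

lemma subspace_E: "subspace E"
  and \<Omega>_E: "\<Omega> \<subseteq> E" and D_\<Omega>: "D \<subseteq> \<Omega>" and convex_\<Omega>: "convex \<Omega>" and closed_\<Omega>: "closed \<Omega>"
  and bounded_D: "bounded D" and D_nonempty: "D \<noteq> {}"
  and h_not_minf: "z \<in> E \<Longrightarrow> h z \<noteq> - \<infinity>"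
  using composite unfolding composite_problem_def proper_h_def by auto

lemma D_E: "D \<subseteq> E" using D_\<Omega> \<Omega>_E by blast

lemma E_span: obtains B where "finite B" "E = span B"
  using composite unfolding composite_problem_def by auto

lemma h_eq_hr: "z \<in> D \<Longrightarrow> h z = ereal (hr z)"
  using h_not_minf[of z] D_E unfolding hr_def dom_h_def by (auto simp: ereal_real)

lemma h_infinite: "z \<in> E \<Longrightarrow> z \<notin> D \<Longrightarrow> h z = \<infinity>"
  unfolding dom_h_def by auto

lemma convex_D: "convex D"
proof (rule convexI)
  fix x y :: 'a and u v :: real
  assume *: "x \<in> D" "y \<in> D" "0 \<le> u" "0 \<le> v" "u + v = 1"
  show "u *\<^sub>R x + v *\<^sub>R y \<in> D"
  proof (cases "v = 0 \<or> v = 1")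
    case True
    then show ?thesis using * by auto
  next
    case False
    then have v: "v \<in> {0<..<1}" "u = 1 - v" using * by auto
    have E: "x \<in> E" "y \<in> E" using * D_E by auto
    then have "h ((1 - v) *\<^sub>R x + v *\<^sub>R y) \<le> ereal (1 - v) * h x + ereal v * h y"
      using composite v(1) unfolding composite_problem_def convex_h_def by blast
    also have "\<dots> < \<infinity>"
      using h_eq_hr *(1,2) by simp
    finally show ?thesis
      using E subspace_E v(2) unfolding dom_h_def
      by (simp add: subspace_add subspace_scale)
  qed
qed

lemma convex_on_hr: "convex_on D hr"
proof (rule convex_onI)
  fix t :: real and x y :: 'a
  assume *: "0 < t" "t < 1" "x \<in> D" "y \<in> D"
  then have E: "x \<in> E" "y \<in> E" using * D_E by auto
  then have "h ((1 - t) *\<^sub>R x + t *\<^sub>R y) \<le> ereal (1 - t) * h x + ereal t * h y"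
    using composite * unfolding composite_problem_def convex_h_def by auto
  moreover have "(1 - t) *\<^sub>R x + t *\<^sub>R y \<in> D"
    using convexD_alt[OF convex_D *(3,4), of t] * by simp
  ultimately show "hr ((1 - t) *\<^sub>R x + t *\<^sub>R y) \<le> (1 - t) * hr x + t * hr y"
    using h_eq_hr * by simp
qed (rule convex_D)

text \<open>A subspace contains the entire line, so a derivative within \<open>E\<close> becomes an
  ordinary two-sided derivative in one real variable.\<close>

lemma has_real_derivative_along_line:
  assumes "(f has_derivative (\<lambda>u. g \<bullet> u)) (at (z + t *\<^sub>R d) within E)" "z \<in> E" "d \<in> E"
  shows "((\<lambda>s. f (z + s *\<^sub>R d)) has_real_derivative g \<bullet> d) (at t)"
proof -
  have "range (\<lambda>s. z + s *\<^sub>R d) \<subseteq> E"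
    using assms(2,3) subspace_E by (auto simp: subspace_add subspace_scale)
  then have 1: "(f has_derivative (\<lambda>u. g \<bullet> u)) (at (z + t *\<^sub>R d) within range (\<lambda>s. z + s *\<^sub>R d))"
    by (rule has_derivative_subset[OF assms(1)])
  have 2: "((\<lambda>s. z + s *\<^sub>R d) has_derivative (\<lambda>s. s *\<^sub>R d)) (at t)"
    by (auto intro!: derivative_eq_intros)
  have "((\<lambda>s. f (z + s *\<^sub>R d)) has_derivative (\<lambda>s. g \<bullet> (s *\<^sub>R d))) (at t)"
    by (rule has_derivative_in_compose[OF 2 1])
  then show ?thesis
    unfolding has_field_derivative_def by (simp add: mult.commute[of _ "g \<bullet> d"])
qed

text \<open>The definite description in \<open>grad\<close> is justified: the Riesz representative
  exists on the finite-dimensional \<open>E\<close>, and two candidates are compared along their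
  difference, which is a direction of \<open>E\<close>.\<close>

lemma grad_in_E: "z \<in> \<Omega> \<Longrightarrow> grad P z \<in> E"
  and has_derivative_grad: "z \<in> \<Omega> \<Longrightarrow> (f has_derivative (\<lambda>u. grad P z \<bullet> u)) (at z within E)"
proof -
  assume z: "z \<in> \<Omega>"
  then have zE: "z \<in> E" using \<Omega>_E by blast
  obtain f' where f': "(f has_derivative f') (at z within E)"
    using composite z unfolding composite_problem_def differentiable_def by auto
  obtain B where B: "finite B" "E = span B" by (rule E_span)
  obtain g where g: "g \<in> span B" "\<And>x. x \<in> span B \<Longrightarrow> f' x = g \<bullet> x"
    using riesz_finite_span[OF B(1) has_derivative_linear[OF f']] by blast
  have diff: "f' (y - z) = g \<bullet> (y - z)" if "y \<in> E" for y
    using g(2)[of "y - z"] that zE subspace_diff[OF subspace_E that zE] B(2) by simp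
  have "((\<lambda>y. (1 / norm (y - z)) *\<^sub>R (f y - (f z + f' (y - z)))) \<longlongrightarrow> 0) (at z within E)"
    using f' unfolding has_derivative_within by blast
  \<comment> \<open>Within \<open>E\<close> the derivative is evaluated only on differences of
    points of \<open>E\<close>, where it agrees with the inner product with
    \<open>g\<close>.\<close>
  moreover have "eventually (\<lambda>y. (1 / norm (y - z)) *\<^sub>R (f y - (f z + f' (y - z)))
      = (1 / norm (y - z)) *\<^sub>R (f y - (f z + g \<bullet> (y - z)))) (at z within E)"
    unfolding eventually_at_filter by (rule always_eventually) (simp add: diff)
  ultimately have "((\<lambda>y. (1 / norm (y - z)) *\<^sub>R (f y - (f z + g \<bullet> (y - z)))) \<longlongrightarrow> 0) (at z within E)"
    by (rule Lim_transform_eventually)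
  then have gd: "(f has_derivative (\<lambda>u. g \<bullet> u)) (at z within E)"
    unfolding has_derivative_within using bounded_linear_inner_right by blast
  have uniq: "g' = g" if g': "g' \<in> E" "(f has_derivative (\<lambda>u. g' \<bullet> u)) (at z within E)" for g'
  proof -
    have d: "g' - g \<in> E" using g' g(1) B(2) subspace_diff[OF subspace_E] by simp
    have "g' \<bullet> (g' - g) = g \<bullet> (g' - g)"
      by (rule DERIV_unique[of "\<lambda>s. f (z + s *\<^sub>R (g' - g))" _ 0];
          rule has_real_derivative_along_line[OF _ zE d]) (use gd g'(2) in simp_all)
    then have "(g' - g) \<bullet> (g' - g) = 0" by (simp add: inner_diff_left)
    then show ?thesis by simp
  qed
  have "grad P z \<in> E \<and> (f has_derivative (\<lambda>u. grad P z \<bullet> u)) (at z within E)"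
    unfolding grad_def by (rule theI[of _ g]) (use g(1)[folded B(2)] gd uniq in blast)+
  then show "grad P z \<in> E" "(f has_derivative (\<lambda>u. grad P z \<bullet> u)) (at z within E)"
    by auto
qed

lemma segment_in_\<Omega>:
  assumes "z \<in> \<Omega>" "z' \<in> \<Omega>" "0 \<le> t" "t \<le> 1"
  shows "z + t *\<^sub>R (z' - z) \<in> \<Omega>"
  using convexD_alt[OF convex_\<Omega> assms] by (simp add: algebra_simps)

text \<open>The descent lemma, proved by monotonicity along the segment instead of integration. The
  sign \<open>e\<close> in the proof yields the upper and the lower estimate at once.\<close>

lemma lipschitz_grad_imp_quadratic_bound:
  assumes M: "lipschitz_grad P M" and z: "z \<in> \<Omega>" "z' \<in> \<Omega>"
  shows "\<bar>f z' - f z - grad P z \<bullet> (z' - z)\<bar> \<le> M / 2 * (norm (z' - z))\<^sup>2"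
proof -
  define d where "d = z' - z"
  have dE: "d \<in> E" "z \<in> E" unfolding d_def using z \<Omega>_E subspace_diff[OF subspace_E] by auto
  have *: "e * (f z' - f z - grad P z \<bullet> d) \<le> M / 2 * (norm d)\<^sup>2" if e: "\<bar>e\<bar> = 1" for e :: real
  proof -
    \<comment> \<open>Up to a constant, this is the signed linearization error at time
      \<open>t\<close> minus its claimed quadratic bound; the Lipschitz estimate makes its
      derivative nonpositive.\<close>
    define \<psi> where "\<psi> t = e * (f (z + t *\<^sub>R d) - t * (grad P z \<bullet> d)) - M / 2 * t\<^sup>2 * (norm d)\<^sup>2" for t
    have "\<psi> 0 \<ge> \<psi> 1"
    proof (rule DERIV_nonpos_imp_nonincreasing[of 0 1 \<psi>])
      fix t :: real assume t: "0 \<le> t" "t \<le> 1"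
      have zt: "z + t *\<^sub>R d \<in> \<Omega>" unfolding d_def using segment_in_\<Omega> z t by blast
      have "(\<psi> has_real_derivative e * (grad P (z + t *\<^sub>R d) \<bullet> d - grad P z \<bullet> d) - M * t * (norm d)\<^sup>2) (at t)"
        unfolding \<psi>_def
        by (rule derivative_eq_intros refl
            has_real_derivative_along_line[OF has_derivative_grad[OF zt] dE(2,1)])+ simp
      moreover have "e * (grad P (z + t *\<^sub>R d) \<bullet> d - grad P z \<bullet> d) \<le> M * t * (norm d)\<^sup>2"
      proof -
        have "e * (grad P (z + t *\<^sub>R d) \<bullet> d - grad P z \<bullet> d)
          \<le> \<bar>e * ((grad P (z + t *\<^sub>R d) - grad P z) \<bullet> d)\<bar>" by (simp add: inner_diff_left)
        also have "\<dots> \<le> norm (grad P (z + t *\<^sub>R d) - grad P z) * norm d"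
          using e by (simp add: abs_mult Cauchy_Schwarz_ineq2)
        also have "\<dots> \<le> (M * norm (t *\<^sub>R d)) * norm d"
          using M[unfolded lipschitz_grad_def, rule_format, OF z(1) zt]
          by (intro mult_right_mono) simp_all
        also have "\<dots> = M * t * (norm d)\<^sup>2" using t by (simp add: power2_eq_square)
        finally show ?thesis .
      qed
      ultimately show "\<exists>y. (\<psi> has_real_derivative y) (at t) \<and> y \<le> 0" by fastforce
    qed simp
    then show ?thesis unfolding \<psi>_def by (simp add: d_def algebra_simps)
  qed
  show ?thesis using *[of 1] *[of "-1"] unfolding d_def abs_le_iff by simp
qed

lemma lipschitz_imp_lower_curvature: "lipschitz_grad P M \<Longrightarrow> lower_curvature P M"
  unfolding lower_curvature_def
proof (intro ballI)
  fix z z' assume M: "lipschitz_grad P M" and z: "z \<in> \<Omega>" "z' \<in> \<Omega>"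
  show "- (M / 2) * (norm (z' - z))\<^sup>2 \<le> f z' - f z - grad P z \<bullet> (z' - z)"
    using lipschitz_grad_imp_quadratic_bound[OF M z] unfolding abs_le_iff by simp
qed

text \<open>The curvature bound at the intermediate point \<open>w\<close> is applied to both
  endpoints. In the average with weights \<open>1 - t\<close> and \<open>t\<close> the gradient
  terms cancel.\<close>

lemma weakly_convex:
  assumes m: "lower_curvature P m" and z: "y \<in> \<Omega>" "u \<in> \<Omega>" and t: "0 \<le> t" "t \<le> 1"
  shows "f ((1 - t) *\<^sub>R y + t *\<^sub>R u)
    \<le> (1 - t) * f y + t * f u + m / 2 * ((1 - t) * t) * (norm (y - u))\<^sup>2"
proof -
  define w where "w = (1 - t) *\<^sub>R y + t *\<^sub>R u"
  have w: "w \<in> \<Omega>" unfolding w_def using convexD_alt[OF convex_\<Omega> z t] .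
  have yw: "y - w = t *\<^sub>R (y - u)" and uw: "u - w = (t - 1) *\<^sub>R (y - u)"
    unfolding w_def by (simp_all add: algebra_simps)
  have "- (m / 2) * (norm (y - w))\<^sup>2 \<le> f y - f w - grad P w \<bullet> (y - w)"
    "- (m / 2) * (norm (u - w))\<^sup>2 \<le> f u - f w - grad P w \<bullet> (u - w)"
    using m w z unfolding lower_curvature_def by blast+
  then have 1: "- (m / 2) * t\<^sup>2 * (norm (y - u))\<^sup>2 \<le> f y - f w - t * (grad P w \<bullet> (y - u))"
   and 2: "- (m / 2) * (1 - t)\<^sup>2 * (norm (y - u))\<^sup>2 \<le> f u - f w + (1 - t) * (grad P w \<bullet> (y - u))"
    unfolding yw uw by (simp_all add: power_mult_distrib power2_commute[of t 1] inner_diff_left left_diff_distrib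
       del: scaleR_diff_right)
  have "(1 - t) * (- (m / 2) * t\<^sup>2 * (norm (y - u))\<^sup>2) + t * (- (m / 2) * (1 - t)\<^sup>2 * (norm (y - u))\<^sup>2)
      \<le> (1 - t) * (f y - f w - t * (grad P w \<bullet> (y - u))) + t * (f u - f w + (1 - t) * (grad P w \<bullet> (y - u)))"
    by (intro add_mono mult_left_mono 1 2) (use t in auto)
  also have "\<dots> = (1 - t) * f y + t * f u - f w" by (simp add: algebra_simps)
  also have "(1 - t) * (- (m / 2) * t\<^sup>2 * (norm (y - u))\<^sup>2) + t * (- (m / 2) * (1 - t)\<^sup>2 * (norm (y - u))\<^sup>2)
      = - (m / 2 * ((1 - t) * t) * (norm (y - u))\<^sup>2)"
    by (simp add: field_simps power2_eq_square)
  finally show ?thesis unfolding w_def by simp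
qed

text \<open>For \<open>m = 0\<close> weak convexity is convexity on \<open>D\<close>, which (A4)
  excludes. This keeps \<open>m_bar\<close> and \<open>M_bar\<close> positive.\<close>

lemma not_lower_curvature_0: "\<not> lower_curvature P 0"
proof
  assume l: "lower_curvature P 0"
  have "convex_on D f"
  proof (rule convex_onI)
    fix t :: real and x y
    assume "0 < t" "t < 1" "x \<in> D" "y \<in> D"
    then show "f ((1 - t) *\<^sub>R x + t *\<^sub>R y) \<le> (1 - t) * f x + t * f y"
      using weakly_convex[OF l, of x y t] D_\<Omega> by auto
  qed (rule convex_D)
  then show False using composite unfolding composite_problem_def by blast
qed

lemma M_bar_pos: "M_bar P > 0" and lipschitz_M_bar: "lipschitz_grad P (M_bar P)"
proof -
  have "0 < M_bar P \<and> lipschitz_grad P (M_bar P)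
     \<and> (\<forall>M. 0 < M \<and> lipschitz_grad P M \<longrightarrow> M_bar P \<le> M)"
    unfolding M_bar_def
  proof (rule least_positive_attained)
    show "\<exists>M>0. lipschitz_grad P M" using composite unfolding composite_problem_def by blast
    show "\<not> lipschitz_grad P 0" using not_lower_curvature_0 lipschitz_imp_lower_curvature by blast
    show "lipschitz_grad P M'" if "lipschitz_grad P M" "M \<le> M'" for M M'
      unfolding lipschitz_grad_def
    proof (intro ballI)
      fix z z' assume z: "z \<in> \<Omega>" "z' \<in> \<Omega>"
      have "norm (grad P z' - grad P z) \<le> M * norm (z' - z)"
        using that(1) z unfolding lipschitz_grad_def by simp
      also have "\<dots> \<le> M' * norm (z' - z)" by (rule mult_right_mono[OF that(2)]) simp
      finally show "norm (grad P z' - grad P z) \<le> M' * norm (z' - z)" .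
    qed
    show "lipschitz_grad P M" if l: "\<And>e. e > 0 \<Longrightarrow> lipschitz_grad P (M + e)" for M
      unfolding lipschitz_grad_def
    proof (intro ballI)
      fix z z' assume "z \<in> \<Omega>" "z' \<in> \<Omega>"
      then show "norm (grad P z' - grad P z) \<le> M * norm (z' - z)"
        by (intro le_mult_if_le_perturbed[OF _ l[unfolded lipschitz_grad_def, rule_format]]) auto
    qed
  qed
  then show "M_bar P > 0" "lipschitz_grad P (M_bar P)" by auto
qed

lemma m_bar_pos: "m_bar P > 0" and lower_curvature_m_bar: "lower_curvature P (m_bar P)"
  and m_bar_le: "0 < m \<Longrightarrow> lower_curvature P m \<Longrightarrow> m_bar P \<le> m"
proof -
  have **: "0 < m_bar P \<and> lower_curvature P (m_bar P)
     \<and> (\<forall>m. 0 < m \<and> lower_curvature P m \<longrightarrow> m_bar P \<le> m)"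
    unfolding m_bar_def
  proof (rule least_positive_attained)
    show "\<exists>m>0. lower_curvature P m" using composite unfolding composite_problem_def by blast
    show "\<not> lower_curvature P 0" using not_lower_curvature_0 .
    \<comment> \<open>This rewriting brings the curvature inequality into the form
      \<open>x \<le> m * r\<close> to which \<open>le_mult_if_le_perturbed\<close> applies.\<close>
    have *: "- (m / 2) * x \<le> c \<longleftrightarrow> - 2 * c \<le> m * x" for m x c :: real by (auto simp: field_simps)
    show "lower_curvature P m'" if "lower_curvature P m" "m \<le> m'" for m m'
      unfolding lower_curvature_def *
    proof (intro ballI)
      fix z z' assume z: "z \<in> \<Omega>" "z' \<in> \<Omega>"
      have "- 2 * (f z' - f z - grad P z \<bullet> (z' - z)) \<le> m * (norm (z' - z))\<^sup>2"
        using that(1) z unfolding lower_curvature_def * by simp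
      also have "\<dots> \<le> m' * (norm (z' - z))\<^sup>2" by (rule mult_right_mono[OF that(2)]) simp
      finally show "- 2 * (f z' - f z - grad P z \<bullet> (z' - z)) \<le> m' * (norm (z' - z))\<^sup>2" .
    qed
    show "lower_curvature P m" if l: "\<And>e. e > 0 \<Longrightarrow> lower_curvature P (m + e)" for m
      unfolding lower_curvature_def *
    proof (intro ballI)
      fix z z' assume "z \<in> \<Omega>" "z' \<in> \<Omega>"
      then show "- 2 * (f z' - f z - grad P z \<bullet> (z' - z)) \<le> m * (norm (z' - z))\<^sup>2"
        by (intro le_mult_if_le_perturbed[OF _ l[unfolded lower_curvature_def *, rule_format]]) auto
    qed
  qed
  then show "m_bar P > 0" "lower_curvature P (m_bar P)" by auto
  show "0 < m \<Longrightarrow> lower_curvature P m \<Longrightarrow> m_bar P \<le> m" using ** by auto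
qed

lemma m_bar_le_M_bar: "m_bar P \<le> M_bar P"
  using m_bar_le[OF M_bar_pos lipschitz_imp_lower_curvature[OF lipschitz_M_bar]] .

end


section \<open>One step of the accelerated method\<close>

text \<open>The scalar part of \<open>one_step\<close>: the first inequality is multiplied by
  \<open>2 * lam * a\<^sup>2\<close> and the second replaces the inner product \<open>I\<close>.
  Condition (i) lets at most nine tenths of \<open>a\<^sup>2 * N\<close> be lost; the remaining
  tenth drives the complexity bound.\<close>

lemma step_combination:
  fixes a s lam C N Z R Q q2 :: real
  assumes 1: "Fy + \<sigma> * I - C / 2 * N \<le> (1 - 1 / a) * p + 1 / a * q
        + mb / 2 * ((1 - 1 / a) * (1 / a)) * Q + \<mu> / 2 * ((1 / a)\<^sup>2 * R)"
    and 2: "a\<^sup>2 * N + (1 + s) * Z - (1 + s / a) * R - s * (a - 1) / a * Q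
         \<le> 2 * (1 + s / a) * (a\<^sup>2 * I)"
    and \<sigma>: "lam * \<sigma> = 1 + s / a" and C: "lam * C \<le> 9 / 10"
    and a: "a \<ge> 2" and lam: "lam > 0" and nn: "s \<ge> 0" "mb \<ge> 0" and Q: "Q \<le> q2" "Q \<ge> 0" "N \<ge> 0"
  shows "2 * lam * a\<^sup>2 * Fy + a\<^sup>2 / 10 * N + (1 + s) * Z
      \<le> 2 * lam * ((a\<^sup>2 - a) * p + a * q) + (lam * mb * a + s) * q2 + (1 + s / a + lam * \<mu>) * R"
proof -
  have "(2 * lam * a\<^sup>2) * (Fy + \<sigma> * I - C / 2 * N) \<le> (2 * lam * a\<^sup>2) * ((1 - 1 / a) * p + 1 / a * q
        + mb / 2 * ((1 - 1 / a) * (1 / a)) * Q + \<mu> / 2 * ((1 / a)\<^sup>2 * R))"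
    using lam by (intro mult_left_mono[OF 1]) simp
  also have "\<dots> = 2 * lam * ((a\<^sup>2 - a) * p + a * q) + lam * mb * (a - 1) * Q + lam * \<mu> * R"
    using a by (simp add: field_simps power2_eq_square)
  also have "(2 * lam * a\<^sup>2) * (Fy + \<sigma> * I - C / 2 * N)
     = 2 * lam * a\<^sup>2 * Fy + 2 * (lam * \<sigma>) * (a\<^sup>2 * I) - (lam * C) * (a\<^sup>2 * N)"
    by (simp add: algebra_simps)
  finally have "2 * lam * a\<^sup>2 * Fy + 2 * (1 + s / a) * (a\<^sup>2 * I) - (lam * C) * (a\<^sup>2 * N)
     \<le> 2 * lam * ((a\<^sup>2 - a) * p + a * q) + lam * mb * (a - 1) * Q + lam * \<mu> * R"
    unfolding \<sigma> .
  moreover have "(lam * C) * (a\<^sup>2 * N) \<le> 9 / 10 * (a\<^sup>2 * N)"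
    using Q(3) by (intro mult_right_mono[OF C]) simp
  moreover have "lam * mb * (a - 1) * Q \<le> lam * mb * a * q2"
    using a lam nn Q by (intro mult_mono) auto
  moreover have "s * (a - 1) / a * Q \<le> s * q2"
  proof (rule mult_mono)
    show "s * (a - 1) / a \<le> s" using a nn(1) by (simp add: pos_divide_le_eq mult_left_mono)
  qed (use nn Q in auto)
  ultimately show ?thesis using 2 by (simp add: algebra_simps)
qed

context composite
begin

lemma \<Omega>_nonempty: "\<Omega> \<noteq> {}" using D_\<Omega> D_nonempty by auto

lemma continuous_on_f: "continuous_on \<Omega> f"
  unfolding continuous_on_eq_continuous_within
proof
  fix z assume "z \<in> \<Omega>"
  then have "continuous (at z within E) f"
    by (rule has_derivative_continuous[OF has_derivative_grad])
  then show "continuous (at z within \<Omega>) f"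
    using \<Omega>_E by (rule continuous_within_subset)
qed

lemma attains_min:
  assumes "continuous_on \<Omega> q"
  obtains z where "z \<in> D" "\<And>u. u \<in> E \<Longrightarrow> h z + ereal (q z) \<le> h u + ereal (q u)"
proof -
  obtain B where B: "finite B" "E = span B" by (rule E_span)
  have D: "{z \<in> span B. h z < \<infinity>} = D" unfolding dom_h_def B(2) ..
  have lsc: "h z \<le> Liminf (at z within span B) h" if "z \<in> span B" for z
    using composite that unfolding composite_problem_def lsc_h_def B(2) by blast
  have cl: "closure {z \<in> span B. h z < \<infinity>} \<subseteq> \<Omega>"
    unfolding D by (rule closure_minimal[OF D_\<Omega> closed_\<Omega>])
  obtain z where z: "z \<in> span B" "\<And>u. u \<in> span B \<Longrightarrow> h z + ereal (q z) \<le> h u + ereal (q u)"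
    by (rule liminf_lsc_attains_min[OF B(1) lsc bounded_D[folded D] D_nonempty[folded D]
          continuous_on_subset[OF assms cl] that])
  obtain u where u: "u \<in> D" using D_nonempty by auto
  have "h z + ereal (q z) < \<infinity>"
    using z(2)[of u] h_eq_hr[OF u] u D_E B(2) by (auto simp: subset_iff elim: le_less_trans)
  then have "h z < \<infinity>" by auto
  then show thesis using that[of z] z B(2) unfolding dom_h_def by simp
qed

section \<open>Optimal value, projection onto the feasible region and prox step\<close>

definition \<phi> :: "'a \<Rightarrow> real" where "\<phi> z = f z + hr z"
definition \<phi>_min :: real where "\<phi>_min = real_of_ereal (phi_star P)"

lemma phi_eq: "z \<in> D \<Longrightarrow> phi P z = ereal (\<phi> z)"
  unfolding phi_def \<phi>_def by (simp add: h_eq_hr)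

lemma phi_star_eq: "phi_star P = ereal \<phi>_min" and optimal_set_nonempty: "optimal_set P \<noteq> {}"
proof -
  obtain z where z: "z \<in> D" "\<And>u. u \<in> E \<Longrightarrow> h z + ereal (f z) \<le> h u + ereal (f u)"
    using attains_min[OF continuous_on_f] by blast
  have zE: "z \<in> E" using z(1) D_E by blast
  have "phi_star P = phi P z"
    unfolding phi_star_def phi_def using z(2) zE
    by (intro antisym INF_lower INF_greatest) (simp_all add: add.commute)
  then show "phi_star P = ereal \<phi>_min" "optimal_set P \<noteq> {}"
    using phi_eq[OF z(1)] zE unfolding \<phi>_min_def optimal_set_def by auto
qed

lemma \<phi>_ge: "z \<in> D \<Longrightarrow> \<phi>_min \<le> \<phi> z"
proof -
  assume z: "z \<in> D"
  then have "phi_star P \<le> phi P z" unfolding phi_star_def using D_E by (blast intro: INF_lower)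
  then show ?thesis using phi_star_eq phi_eq[OF z] by simp
qed

lemma optimal_set_D: "z \<in> optimal_set P \<Longrightarrow> z \<in> D"
  and \<phi>_optimal: "z \<in> optimal_set P \<Longrightarrow> \<phi> z = \<phi>_min"
proof -
  assume "z \<in> optimal_set P"
  then have z: "z \<in> E" "phi P z = ereal \<phi>_min" using phi_star_eq unfolding optimal_set_def by auto
  then show D: "z \<in> D" using h_infinite[of z] unfolding phi_def by (cases "z \<in> D") auto
  show "\<phi> z = \<phi>_min" using z(2) phi_eq[OF D] by simp
qed

lemma primal_gap_eq: "z \<in> D \<Longrightarrow> primal_gap P z = \<phi> z - \<phi>_min"
  unfolding primal_gap_def using phi_star_eq phi_eq[of z] by simp

lemma norm_diff_le_D_h: "y \<in> D \<Longrightarrow> u \<in> D \<Longrightarrow> norm (y - u) \<le> D_h P"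
  unfolding D_h_def using diameter_bounded_bound[OF bounded_D, of y u] by (simp add: dist_norm)

lemma proj_region_in: "proj_region P p \<in> \<Omega>"
  and proj_region_min: "w \<in> \<Omega> \<Longrightarrow> norm (proj_region P p - p) \<le> norm (w - p)"
proof -
  obtain w0 where w0: "w0 \<in> \<Omega>" using \<Omega>_nonempty by blast
  obtain B where B: "finite B" "E = span B" by (rule E_span)
  \<comment> \<open>Intersecting with a ball gives a compact set, and points of
    \<open>\<Omega>\<close> outside of the ball are farther from \<open>p\<close> than
    \<open>w0\<close>.\<close>
  let ?K = "\<Omega> \<inter> cball p (dist p w0)"
  have "compact ?K"
  proof (rule compact_closed_bounded_in_span[OF B(1)])
    show "?K \<subseteq> span B" using \<Omega>_E B(2) by blast
    show "bounded ?K" by (rule bounded_subset[OF bounded_cball]) blast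
    show "closed ?K" by (intro closed_Int closed_\<Omega> closed_cball)
  qed
  moreover have "?K \<noteq> {}" using w0 by auto
  ultimately obtain x where x: "x \<in> ?K" "\<forall>y\<in>?K. norm (x - p) \<le> norm (y - p)"
    using continuous_attains_inf[of ?K "\<lambda>w. norm (w - p)"] by (fastforce intro!: continuous_intros)
  have "norm (x - p) \<le> norm (w - p)" if "w \<in> \<Omega>" for w
  proof (cases "dist p w \<le> dist p w0")
    case True
    then show ?thesis using x(2) that by simp
  next
    case False
    then show ?thesis using x(1) by (simp add: dist_norm norm_minus_commute)
  qed
  then have "is_arg_min (\<lambda>w. norm (w - p)) (\<lambda>w. w \<in> \<Omega>) x"
    using x(1) unfolding is_arg_min_def by (auto simp: not_less)
  then have "is_arg_min (\<lambda>w. norm (w - p)) (\<lambda>w. w \<in> \<Omega>) (proj_region P p)"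
    unfolding proj_region_def arg_min_on_def arg_min_def by (rule someI)
  then show "proj_region P p \<in> \<Omega>" "w \<in> \<Omega> \<Longrightarrow> norm (proj_region P p - p) \<le> norm (w - p)"
    unfolding is_arg_min_def by (auto simp: not_less)
qed

lemma proj_region_variational:
  "u \<in> \<Omega> \<Longrightarrow> (p - proj_region P p) \<bullet> (u - proj_region P p) \<le> 0"
  by (intro closest_point_variational[OF convex_\<Omega>] proj_region_in proj_region_min)

definition prox_coef :: "'a fista_state \<Rightarrow> real \<Rightarrow> real \<Rightarrow> real" where
  "prox_coef S lam m = 1 / lam + 2 * m / coef_a S"

text \<open>The choice made by \<open>arg_min_on\<close> is a minimizer because one exists: the
  objective is regrouped as \<open>h\<close> plus a continuous real function, so that
  \<open>attains_min\<close> applies. Comparison with a point of \<open>D\<close> forces a finite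
  value and hence membership in \<open>D\<close>.\<close>

lemma y_trial_D: "y_trial P S lam m \<in> D"
  and y_trial_min: "z \<in> D \<Longrightarrow>
    grad P (x_tilde S) \<bullet> y_trial P S lam m + hr (y_trial P S lam m)
      + prox_coef S lam m / 2 * (norm (y_trial P S lam m - x_tilde S))\<^sup>2
    \<le> grad P (x_tilde S) \<bullet> z + hr z + prox_coef S lam m / 2 * (norm (z - x_tilde S))\<^sup>2"
proof -
  define q where "q u = lin_f P u (x_tilde S)
    + 1/2 * (1 / lam + 2 * m / coef_a S) * (norm (u - x_tilde S))\<^sup>2" for u
  define F where "F u = ereal (lin_f P u (x_tilde S)) + h u
    + ereal (1/2 * (1 / lam + 2 * m / coef_a S) * (norm (u - x_tilde S))\<^sup>2)" for u
  have Fq: "F u = h u + ereal (q u)" for u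
    unfolding F_def q_def by (cases "h u") auto
  have "continuous_on \<Omega> q"
    unfolding q_def lin_f_def by (intro continuous_intros)
  then obtain x where x: "x \<in> D" "\<And>u. u \<in> E \<Longrightarrow> F x \<le> F u"
    using attains_min unfolding Fq by blast
  have xE: "x \<in> E" using x(1) D_E by blast
  define y where "y = y_trial P S lam m"
  have "is_arg_min F (\<lambda>u. u \<in> E) x"
    using x(2) xE unfolding is_arg_min_def by (simp add: not_less)
  then have "is_arg_min F (\<lambda>u. u \<in> E) y"
    unfolding y_def y_trial_def F_def[abs_def] arg_min_on_def arg_min_def by (rule someI)
  then have y: "y \<in> E" "\<And>u. u \<in> E \<Longrightarrow> F y \<le> F u"
    unfolding is_arg_min_def by (auto simp: not_less)
  have "F y < \<infinity>" using y(2)[OF xE] h_eq_hr[OF x(1)] unfolding Fq by (auto elim: le_less_trans)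
  then have yD: "y \<in> D" using y(1) unfolding Fq dom_h_def by auto
  then show "y_trial P S lam m \<in> D" unfolding y_def .
  assume z: "z \<in> D"
  show "grad P (x_tilde S) \<bullet> y_trial P S lam m + hr (y_trial P S lam m)
      + prox_coef S lam m / 2 * (norm (y_trial P S lam m - x_tilde S))\<^sup>2
    \<le> grad P (x_tilde S) \<bullet> z + hr z + prox_coef S lam m / 2 * (norm (z - x_tilde S))\<^sup>2"
    using y(2)[of z] h_eq_hr[OF z] h_eq_hr[OF yD] z D_E
    unfolding Fq q_def y_def[symmetric] prox_coef_def lin_f_def
    by (auto simp: inner_diff_right subset_iff)
qed

lemma y_trial_prox:
  fixes S lam m
  assumes "u \<in> D"
  defines "y \<equiv> y_trial P S lam m"
  shows "hr y + (prox_coef S lam m *\<^sub>R (x_tilde S - y) - grad P (x_tilde S)) \<bullet> (u - y) \<le> hr u"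
  unfolding y_def
  by (rule prox_inequality[OF convex_on_hr y_trial_D assms(1) y_trial_min])

text \<open>The prox inequality says that \<open>prox_coef\<close> times the displacement, minus the
  gradient at \<open>x_tilde\<close>, is a subgradient of \<open>h\<close> at \<open>y\<close>.
  Adding \<open>grad P y\<close> gives the vector \<open>v\<close> of the algorithm.\<close>

lemma y_trial_stationary:
  fixes S lam m
  assumes x: "x_tilde S \<in> \<Omega>"
  defines "y \<equiv> y_trial P S lam m"
  shows "stationary_pair P y (prox_coef S lam m *\<^sub>R (x_tilde S - y) + grad P y - grad P (x_tilde S))"
proof -
  define w where "w = prox_coef S lam m *\<^sub>R (x_tilde S - y) - grad P (x_tilde S)"
  have yD: "y \<in> D" unfolding y_def by (rule y_trial_D)
  then have E: "y \<in> E" "x_tilde S \<in> E" "grad P (x_tilde S) \<in> E"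
    using x D_E \<Omega>_E grad_in_E[OF x] by auto
  then have "w \<in> E" unfolding w_def using subspace_E
    by (intro subspace_diff subspace_scale)
  moreover have "h y + ereal (w \<bullet> (u - y)) \<le> h u" if "u \<in> E" for u
  proof (cases "u \<in> D")
    case True
    then show ?thesis
      using y_trial_prox[OF True, of S lam m] h_eq_hr[OF True] h_eq_hr[OF yD]
      unfolding w_def y_def by simp
  next
    case False
    then show ?thesis using h_infinite[OF that] by simp
  qed
  ultimately have "w \<in> subdiff_h P y" unfolding subdiff_h_def by simp
  then show ?thesis
    unfolding stationary_pair_def w_def by (rule rev_image_eqI) simp
qed

lemma C_trial_eq:
  "f (y_trial P S lam m) = lin_f P (y_trial P S lam m) (x_tilde S)
     + C_trial P S lam m / 2 * (norm (y_trial P S lam m - x_tilde S))\<^sup>2"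
  by (cases "y_trial P S lam m = x_tilde S") (simp_all add: C_trial_def lin_f_def field_simps)

lemma C_trial_le:
  assumes x: "x_tilde S \<in> \<Omega>"
  shows "C_trial P S lam m \<le> M_bar P"
proof (cases "y_trial P S lam m = x_tilde S")
  case True
  then show ?thesis using M_bar_pos by (simp add: C_trial_def)
next
  case False
  have "y_trial P S lam m \<in> \<Omega>" using y_trial_D D_\<Omega> by blast
  from lipschitz_grad_imp_quadratic_bound[OF lipschitz_M_bar x this]
  show ?thesis using False unfolding C_trial_def lin_f_def
    unfolding abs_le_iff by (simp add: pos_divide_le_eq)
qed

lemma m_lower_bound:
  "lin_f P (y_tilde u S) (x_tilde S) - f (y_tilde u S)
     \<le> m_lower P u S / 2 * (norm (y_tilde u S - x_tilde S))\<^sup>2"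
proof (cases "y_tilde u S = x_tilde S")
  case True
  then show ?thesis by (simp add: lin_f_def)
next
  case False
  then have "0 < (norm (y_tilde u S - x_tilde S))\<^sup>2" by simp
  moreover have "2 * (lin_f P (y_tilde u S) (x_tilde S) - f (y_tilde u S))
            / (norm (y_tilde u S - x_tilde S))\<^sup>2 \<le> m_lower P u S"
    unfolding m_lower_def by simp
  ultimately show ?thesis by (simp add: pos_divide_le_eq)
qed

lemma curvature_bound:
  assumes "x \<in> \<Omega>" "y \<in> \<Omega>"
  shows "lin_f P y x - f y \<le> m_bar P / 2 * (norm (y - x))\<^sup>2"
  using lower_curvature_m_bar assms unfolding lower_curvature_def lin_f_def by fastforce

lemma m_lower_le:
  assumes "x_tilde S \<in> \<Omega>" "y_tilde u S \<in> \<Omega>"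
  shows "m_lower P u S \<le> m_bar P"
proof (cases "y_tilde u S = x_tilde S")
  case True
  then show ?thesis using m_bar_pos by (simp add: m_lower_def)
next
  case False
  then show ?thesis
    using curvature_bound[OF assms] m_bar_pos unfolding m_lower_def
    by (simp add: pos_divide_le_eq)
qed

text \<open>\<open>coef_a\<close> is the positive root of \<open>a\<^sup>2 = A + a\<close>. Hence
  the next \<open>A\<close> is \<open>a\<^sup>2\<close>, and the averages defining
  \<open>x_tilde\<close> and \<open>y_tilde\<close> have weights \<open>1 - 1 / a\<close> and
  \<open>1 / a\<close>.\<close>

lemma coef_a_square: "st_A S \<ge> 0 \<Longrightarrow> (coef_a S)\<^sup>2 = st_A S + coef_a S"
  unfolding coef_a_def by (simp add: power2_eq_square field_simps)

lemma A_next_eq: "st_A S \<ge> 0 \<Longrightarrow> A_next S = (coef_a S)\<^sup>2"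
  unfolding A_next_def by (simp add: coef_a_square)

lemma coef_a_ge_2: "st_A S \<ge> 2 \<Longrightarrow> coef_a S \<ge> 2"
proof -
  assume "st_A S \<ge> 2"
  then have "3 \<le> sqrt (1 + 4 * st_A S)" by (intro real_le_rsqrt) simp
  then show ?thesis unfolding coef_a_def by simp
qed

lemma tilde_eq:
  assumes "st_A S \<ge> 2"
  shows "x_tilde S = (1 - 1 / coef_a S) *\<^sub>R st_y S + (1 / coef_a S) *\<^sub>R st_x S"
    and "y_tilde u S = (1 - 1 / coef_a S) *\<^sub>R st_y S + (1 / coef_a S) *\<^sub>R u"
proof -
  have a: "coef_a S \<ge> 2" and A: "A_next S = (coef_a S)\<^sup>2" "st_A S = (coef_a S)\<^sup>2 - coef_a S"
    using assms coef_a_ge_2[of S] A_next_eq[of S] coef_a_square[of S] by auto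
  have "1 / A_next S * st_A S = 1 - 1 / coef_a S" "1 / A_next S * coef_a S = 1 / coef_a S"
    using a unfolding A by (simp_all add: field_simps power2_eq_square)
  then show "x_tilde S = (1 - 1 / coef_a S) *\<^sub>R st_y S + (1 / coef_a S) *\<^sub>R st_x S"
    "y_tilde u S = (1 - 1 / coef_a S) *\<^sub>R st_y S + (1 / coef_a S) *\<^sub>R u"
    unfolding x_tilde_def y_tilde_def scaleR_add_right scaleR_scaleR by simp_all
qed

definition valid_state :: "'a fista_state \<Rightarrow> bool" where
  "valid_state S \<longleftrightarrow> st_y S \<in> D \<and> st_x S \<in> \<Omega> \<and> st_A S \<ge> 2 \<and> st_lam S > 0 \<and> st_m S > 0"

lemma tilde_in_\<Omega>:
  assumes "valid_state S"
  shows "x_tilde S \<in> \<Omega>" "u \<in> \<Omega> \<Longrightarrow> y_tilde u S \<in> \<Omega>"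
proof -
  have S: "st_y S \<in> \<Omega>" "st_x S \<in> \<Omega>" "st_A S \<ge> 2"
    using assms D_\<Omega> unfolding valid_state_def by auto
  have t: "0 \<le> 1 / coef_a S" "1 / coef_a S \<le> 1" using coef_a_ge_2[OF S(3)] by simp_all
  show "x_tilde S \<in> \<Omega>" unfolding tilde_eq[OF S(3)] by (rule convexD_alt[OF convex_\<Omega> S(1,2) t])
  show "y_tilde u S \<in> \<Omega>" if "u \<in> \<Omega>"
    unfolding tilde_eq[OF S(3)] by (rule convexD_alt[OF convex_\<Omega> S(1) that t])
qed

text \<open>The reference point \<open>u\<close> and the curvature \<mu> are left open: they become
  \<open>y0\<close> with the computed \<open>m_lower\<close>, or an optimal point with
  \<open>m_bar\<close>.\<close>

lemma one_step:
  fixes S lam m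
  assumes S: "valid_state S" and pos: "lam > 0" "m > 0" and u: "u \<in> D"
    and i: "cond_i P S lam m"
    and \<mu>: "lin_f P (y_tilde u S) (x_tilde S) - f (y_tilde u S)
              \<le> \<mu> / 2 * (norm (y_tilde u S - x_tilde S))\<^sup>2"
  defines "a \<equiv> coef_a S" and "y' \<equiv> y_trial P S lam m"
  defines "x' \<equiv> proj_region P
             ((1 / (2 * m * lam + 1)) *\<^sub>R ((a + 2 * m * lam) *\<^sub>R y' - (a - 1) *\<^sub>R st_y S))"
  shows "2 * lam * a\<^sup>2 * \<phi> y' + a\<^sup>2 / 10 * (norm (x_tilde S - y'))\<^sup>2
           + (1 + 2 * m * lam) * (norm (u - x'))\<^sup>2
         \<le> 2 * lam * (st_A S * \<phi> (st_y S) + a * \<phi> u) + (lam * m_bar P * a + 2 * m * lam) * (D_h P)\<^sup>2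
           + (1 + 2 * m * lam / a + lam * \<mu>) * (norm (u - st_x S))\<^sup>2"
proof -
  define y x w v where yxwv: "y = st_y S" "x = st_x S" "w = x_tilde S" "v = y_tilde u S"
  define \<sigma> g C where \<sigma>gC: "\<sigma> = prox_coef S lam m" "g = grad P w" "C = C_trial P S lam m"
  define s where "s = 2 * m * lam"
  have yD: "y \<in> D" and A: "st_A S \<ge> 2" using S unfolding yxwv valid_state_def by auto
  have a: "a \<ge> 2" and Aa: "st_A S = a\<^sup>2 - a"
    unfolding a_def using coef_a_ge_2[OF A] coef_a_square[of S] A by auto
  have a': "1 / a \<le> 1" "0 \<le> 1 / a" using a by simp_all
  have y'D: "y' \<in> D" unfolding y'_def by (rule y_trial_D)
  have w: "w = (1 - 1 / a) *\<^sub>R y + (1 / a) *\<^sub>R x" and v: "v = (1 - 1 / a) *\<^sub>R y + (1 / a) *\<^sub>R u"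
    unfolding yxwv a_def using tilde_eq[OF A] by auto
  have vw: "v - w = (1 / a) *\<^sub>R (u - x)" unfolding v w by (simp add: algebra_simps)
  have s: "s > 0" unfolding s_def using pos by simp

  have "hr y' + (\<sigma> *\<^sub>R (w - y') - g) \<bullet> (y - y') \<le> hr y"
    "hr y' + (\<sigma> *\<^sub>R (w - y') - g) \<bullet> (u - y') \<le> hr u"
    unfolding y'_def \<sigma>gC yxwv(3) by (intro y_trial_prox yD u)+
  \<comment> \<open>Averaging with the weights that define \<open>v\<close> turns the two prox
    inequalities into a single one in the direction \<open>v - y'\<close>.\<close>
  then have "(1 - 1 / a) * (hr y' + (\<sigma> *\<^sub>R (w - y') - g) \<bullet> (y - y'))
       + 1 / a * (hr y' + (\<sigma> *\<^sub>R (w - y') - g) \<bullet> (u - y'))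
      \<le> (1 - 1 / a) * hr y + 1 / a * hr u"
    using a' by (intro add_mono mult_left_mono) auto
  moreover have "v - y' = (1 - 1 / a) *\<^sub>R (y - y') + (1 / a) *\<^sub>R (u - y')"
    unfolding v by (simp add: algebra_simps)
  ultimately have prox: "hr y' + (\<sigma> *\<^sub>R (w - y') - g) \<bullet> (v - y') \<le> (1 - 1 / a) * hr y + 1 / a * hr u"
    by (simp only: inner_add_right[of _ "(1 - 1 / a) *\<^sub>R (y - y')"] inner_scaleR_right)
       (simp add: algebra_simps)
  have lin: "f w + g \<bullet> (v - w) \<le> f v + \<mu> / 2 * ((1 / a)\<^sup>2 * (norm (u - x))\<^sup>2)"
    using \<mu> unfolding yxwv[symmetric] lin_f_def vw \<sigma>gC by (simp add: power_mult_distrib power_divide)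
  have weak: "f v \<le> (1 - 1 / a) * f y + 1 / a * f u
      + m_bar P / 2 * ((1 - 1 / a) * (1 / a)) * (norm (y - u))\<^sup>2"
    unfolding v using yD u D_\<Omega> by (intro weakly_convex lower_curvature_m_bar a') auto
  have desc: "f y' = f w + g \<bullet> (y' - w) + C / 2 * (norm (w - y'))\<^sup>2"
    using C_trial_eq[of S lam m] unfolding lin_f_def y'_def yxwv \<sigma>gC by (simp add: norm_minus_commute)
  have inn: "(\<sigma> *\<^sub>R (w - y') - g) \<bullet> (v - y')
      = \<sigma> * ((w - y') \<bullet> (v - y')) + g \<bullet> (y' - w) - g \<bullet> (v - w)"
    by (simp add: inner_diff_left inner_diff_right algebra_simps)
  \<comment> \<open>\<open>lin\<close> pays \<mu> for linearizing at \<open>w\<close> instead of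
    \<open>v\<close>, \<open>weak\<close> pays \<open>m_bar\<close> for splitting \<open>f v\<close>
    between \<open>y\<close> and \<open>u\<close>, and \<open>desc\<close> expresses
    \<open>f y'\<close> through \<open>C\<close>. The gradient terms cancel.\<close>
  have main1: "\<phi> y' + \<sigma> * ((w - y') \<bullet> (v - y')) - C / 2 * (norm (w - y'))\<^sup>2
      \<le> (1 - 1 / a) * \<phi> y + 1 / a * \<phi> u
        + m_bar P / 2 * ((1 - 1 / a) * (1 / a)) * (norm (y - u))\<^sup>2
        + \<mu> / 2 * ((1 / a)\<^sup>2 * (norm (u - x))\<^sup>2)"
    using prox lin weak desc unfolding inn \<phi>_def by (simp add: algebra_simps)

  define p where "p = (1 / (s + 1)) *\<^sub>R ((a + s) *\<^sub>R y' - (a - 1) *\<^sub>R y)"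
  have sp: "(s + 1) *\<^sub>R p = (a + s) *\<^sub>R y' - (a - 1) *\<^sub>R y"
    unfolding p_def scaleR_scaleR using s by simp
  have x': "x' = proj_region P p" unfolding x'_def p_def s_def yxwv by simp
  have "(p - x') \<bullet> (u - x') \<le> 0"
    unfolding x' using u D_\<Omega> by (intro proj_region_variational) auto
  then have "(s + 1) * ((p - x') \<bullet> (u - x')) \<le> 0" using s by (simp add: mult_le_0_iff)
  moreover have "(s + 1) *\<^sub>R (p - x') = - (a - 1) *\<^sub>R (y - y') - (1 + s) *\<^sub>R (x' - y')"
    unfolding scaleR_diff_right[of "s + 1" p] sp by (simp add: algebra_simps)
  \<comment> \<open>The projection inequality is scaled by \<open>s + 1\<close> and translated by
    \<open>y'\<close>, which is the origin in
    \<open>accelerated_step_vector_inequality\<close>.\<close>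
  ultimately have vi: "(- (a - 1) *\<^sub>R (y - y') - (1 + s) *\<^sub>R (x' - y')) \<bullet> ((u - y') - (x' - y')) \<le> 0"
    by (metis diff_diff_eq2 diff_add_cancel inner_scaleR_left)
  have aT: "a *\<^sub>R (w - y') = (a - 1) *\<^sub>R (y - y') + (x - y')"
    using a unfolding w by (simp add: algebra_simps)
  have av: "(a - 1) *\<^sub>R (y - y') + (u - y') = a *\<^sub>R (v - y')"
    using a unfolding v by (simp add: algebra_simps)
  have main2: "a\<^sup>2 * (norm (w - y'))\<^sup>2 + (1 + s) * (norm (u - x'))\<^sup>2
           - (1 + s / a) * (norm (u - x))\<^sup>2 - s * (a - 1) / a * (norm (y - u))\<^sup>2
         \<le> 2 * (1 + s / a) * (a\<^sup>2 * ((w - y') \<bullet> (v - y')))"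
    using accelerated_step_vector_inequality[OF _ _ aT vi] a s unfolding av
    by (simp add: power2_eq_square mult.assoc)
  have Q: "(norm (y - u))\<^sup>2 \<le> (D_h P)\<^sup>2"
    using norm_diff_le_D_h[OF yD u] by (intro power_mono) auto
  have \<sigma>: "lam * \<sigma> = 1 + s / a"
    unfolding \<sigma>gC prox_coef_def s_def a_def using pos by (simp add: field_simps)
  have lC: "lam * C \<le> 9 / 10" using i unfolding cond_i_def \<sigma>gC .
  have "2 * lam * a\<^sup>2 * \<phi> y' + a\<^sup>2 / 10 * (norm (w - y'))\<^sup>2 + (1 + s) * (norm (u - x'))\<^sup>2
      \<le> 2 * lam * ((a\<^sup>2 - a) * \<phi> y + a * \<phi> u) + (lam * m_bar P * a + s) * (D_h P)\<^sup>2
        + (1 + s / a + lam * \<mu>) * (norm (u - x))\<^sup>2"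
    by (rule step_combination[OF main1 main2 \<sigma> lC a pos(1) _ _ Q])
       (use s m_bar_pos in auto)
  then show ?thesis
    unfolding Aa yxwv s_def .
qed

end


section \<open>Passes of SUB\<close>

lemma cubic_bound:
  fixes n q X Y W :: real
  assumes "n \<ge> 0" "q \<ge> 1" "X \<ge> 0" "Y \<ge> 0" "W \<ge> 0"
    and "n ^ 3 \<le> q * (X + n\<^sup>2 * Y + n * W)"
  shows "n \<le> q * (X powr (1/3) + W powr (1/2) + Y)"
proof (rule ccontr)
  define x w where "x = X powr (1/3)" "w = W powr (1/2)"
  \<comment> \<open>If \<open>n\<close> exceeds the claimed bound, then it exceeds both roots
    \<open>x\<close> and \<open>w\<close>. So \<open>X\<close> and \<open>n * W\<close> are at most
    \<open>n\<^sup>2 * x\<close> and \<open>n\<^sup>2 * w\<close>, which makes the right-hand side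
    smaller than \<open>n ^ 3\<close>.\<close>
  assume "\<not> n \<le> q * (X powr (1/3) + W powr (1/2) + Y)"
  then have n: "q * (x + w + Y) < n" unfolding x_w_def by simp
  have x: "x ^ 3 = X" "x \<ge> 0" and w: "w\<^sup>2 = W" "w \<ge> 0"
    unfolding x_w_def using assms(3,5)
    by (simp_all add: powr_powr flip: powr_numeral)
  have "1 * (x + w + Y) \<le> q * (x + w + Y)"
    using x w assms by (intro mult_right_mono) auto
  then have "x + w + Y < n" using n by simp
  then have le: "x \<le> n" "w \<le> n" "0 < n" using x w assms by auto
  have "X + n\<^sup>2 * Y + n * W \<le> n\<^sup>2 * x + n\<^sup>2 * Y + n\<^sup>2 * w"
  proof -
    have "x\<^sup>2 * x \<le> n\<^sup>2 * x" using le x by (intro mult_right_mono power_mono) auto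
    moreover have "n * (w * w) \<le> n * (n * w)" using le w by (intro mult_left_mono mult_right_mono) auto
    ultimately show ?thesis using x(1) w(1) by (simp add: power2_eq_square power3_eq_cube mult.assoc)
  qed
  then have "q * (X + n\<^sup>2 * Y + n * W) \<le> q * (n\<^sup>2 * x + n\<^sup>2 * Y + n\<^sup>2 * w)"
    using assms(2) by (intro mult_left_mono) auto
  also have "\<dots> = n\<^sup>2 * (q * (x + w + Y))" by (simp add: algebra_simps)
  also have "\<dots> < n\<^sup>2 * n" using n le by (intro mult_strict_left_mono) auto
  also have "\<dots> = n ^ 3" by (simp add: power2_eq_square power3_eq_cube)
  finally show False using assms(6) by simp
qed

text \<open>Solved for the distance, the hypothesis bounds every \<open>dist y u\<close> from below,
  and this bound passes to the infimum.\<close>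

lemma le_infdist_square:
  fixes \<alpha> \<beta> \<gamma> :: real
  assumes "Z \<noteq> {}" "\<gamma> > 0" "\<And>u. u \<in> Z \<Longrightarrow> \<alpha> \<le> \<beta> + \<gamma> * (dist y u)\<^sup>2"
  shows "\<alpha> \<le> \<beta> + \<gamma> * (infdist y Z)\<^sup>2"
proof (cases "\<alpha> \<le> \<beta>")
  case True
  moreover have "0 \<le> \<gamma> * (infdist y Z)\<^sup>2" using assms(2) by simp
  ultimately show ?thesis by linarith
next
  case False
  have "sqrt ((\<alpha> - \<beta>) / \<gamma>) \<le> dist y u" if "u \<in> Z" for u
    using assms(3)[OF that] assms(2) by (intro real_le_lsqrt) (auto simp: pos_divide_le_eq mult.commute)
  then have "sqrt ((\<alpha> - \<beta>) / \<gamma>) \<le> infdist y Z"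
    unfolding infdist_notempty[OF assms(1)] by (intro cINF_greatest[OF assms(1)])
  then have "(\<alpha> - \<beta>) / \<gamma> \<le> (infdist y Z)\<^sup>2"
    by (rule sqrt_le_D)
  then show ?thesis using assms(2) by (simp add: pos_divide_le_eq mult.commute)
qed

lemma C_2_nonneg: "0 \<le> C_2 P M0" unfolding C_2_def by simp

text \<open>
  Real-valued upper bounds for how often SUB may still reject \<open>\<lambda>\<close>, which divides it by at least
  \<open>\<theta>\<close> and requires \<open>\<lambda> M > 9/10\<close>, and \<open>m\<close>, which doubles it and requires \<open>m < mb\<close>.
\<close>

definition lam_budget :: "real \<Rightarrow> real \<Rightarrow> real \<Rightarrow> real" where
  "lam_budget \<theta> M lam = max 0 (1 + ln (lam * M / (9/10)) / ln \<theta>)"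

definition m_budget :: "real \<Rightarrow> real \<Rightarrow> real" where
  "m_budget mb m = max 0 (1 + ln (mb / m) / ln 2)"

lemma lam_budget_mono:
  "\<theta> > 1 \<Longrightarrow> M > 0 \<Longrightarrow> 0 < lam' \<Longrightarrow> lam' \<le> lam \<Longrightarrow> lam_budget \<theta> M lam' \<le> lam_budget \<theta> M lam"
  unfolding lam_budget_def
  by (intro max.mono add_left_mono divide_right_mono order_refl) (auto intro!: ln_mono divide_right_mono)

text \<open>While \<open>lam * M > 9/10\<close> the logarithm is nonnegative. The summand 1 in the
  budget then keeps \<open>max 0\<close> inactive before and after a division by \<theta>, so the
  budget drops by exactly 1; a smaller \<open>lam'\<close> only lowers it further.\<close>

lemma lam_budget_decrease:
  assumes "\<theta> > 1" "M > 0" "0 < lam'" "lam' \<le> lam / \<theta>" "lam * M > 9/10"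
  shows "lam_budget \<theta> M lam' + 1 \<le> lam_budget \<theta> M lam"
proof -
  have lam: "lam > 0" using zero_less_mult_pos2[of lam M] assms(2,5) by linarith
  have "ln (lam / \<theta> * M / (9/10)) = ln (lam * M / (9/10)) - ln \<theta>"
    using assms(1,2) lam by (simp add: ln_div ln_mult)
  then have "ln (lam / \<theta> * M / (9/10)) / ln \<theta> = ln (lam * M / (9/10)) / ln \<theta> - 1"
    using assms(1) by (simp add: diff_divide_distrib)
  moreover have "ln (lam * M / (9/10)) / ln \<theta> \<ge> 0"
    using assms(1,5) by (intro divide_nonneg_nonneg) auto
  ultimately have "lam_budget \<theta> M (lam / \<theta>) + 1 = lam_budget \<theta> M lam"
    unfolding lam_budget_def by simp
  then show ?thesis using lam_budget_mono[OF assms(1-4)] by simp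
qed

lemma m_budget_decrease:
  assumes "0 < m" "m < mb"
  shows "m_budget mb (2 * m) + 1 = m_budget mb m"
proof -
  have "ln (mb / (2 * m)) = ln (mb / m) - ln 2"
    using assms by (simp add: ln_div ln_mult)
  then have "ln (mb / (2 * m)) / ln 2 = ln (mb / m) / ln 2 - 1"
    by (simp add: diff_divide_distrib)
  moreover have "ln (mb / m) / ln 2 \<ge> 0" using assms by simp
  ultimately show ?thesis unfolding m_budget_def by simp
qed

text \<open>The lower bound 1 in \<open>log1_plus\<close> absorbs all additive constants, including
  \<open>ln (10/9)\<close> from the threshold 0.9.\<close>

lemma budget_le_log1_plus:
  assumes "\<theta> > 1" "M > 0" "M0 > 0" "mb > 0" "m0 > 0"
  shows "lam_budget \<theta> M (1 / M0) + m_budget mb m0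
    \<le> (4 + 2 / ln \<theta>) * log1_plus (max (M / M0) (mb / m0))"
proof -
  define l where "l = log1_plus (max (M / M0) (mb / m0))"
  have l1: "l \<ge> 1" and l: "ln (max (M / M0) (mb / m0)) \<le> l" unfolding l_def log1_plus_def by auto
  have "ln (M / M0) \<le> ln (max (M / M0) (mb / m0))" "ln (mb / m0) \<le> ln (max (M / M0) (mb / m0))"
    using assms by (auto intro!: ln_mono simp: less_max_iff_disj)
  then have lM: "ln (M / M0) \<le> l" and lm: "ln (mb / m0) \<le> l" using l by auto
  have "ln (1 / M0 * M / (9/10)) = ln (M / M0) + ln (10/9)"
    using assms by (simp add: ln_div ln_mult)
  also have "\<dots> \<le> 2 * l"
    using lM l1 ln_le_minus_one[of "10/9 :: real"] by simp
  finally have "lam_budget \<theta> M (1 / M0) \<le> 1 + 2 * l / ln \<theta>"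
    unfolding lam_budget_def using assms(1) l1 by (auto intro!: divide_right_mono)
  moreover have "m_budget mb m0 \<le> 1 + 2 * l"
  proof -
    \<comment> \<open>From \<open>ln (1/2) \<le> - 1/2\<close>.\<close>
    have "1/2 \<le> ln (2::real)" using ln_le_minus_one[of "1/2 :: real"] by (simp add: ln_div)
    then have "l * 1 \<le> l * (2 * ln 2)" using l1 by (intro mult_left_mono) auto
    then have "ln (mb / m0) / ln 2 \<le> 2 * l" using lm by (simp add: pos_divide_le_eq mult_ac)
    then show ?thesis unfolding m_budget_def using l1 by simp
  qed
  ultimately have "lam_budget \<theta> M (1 / M0) + m_budget mb m0 \<le> 4 * l + 2 / ln \<theta> * l"
    using l1 by simp
  then show ?thesis unfolding l_def by (simp add: distrib_right)
qed

section \<open>Termination of SUB and the range of its pairs\<close>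

locale fista_run = composite +
  fixes \<theta> :: real and y0 :: 'a and M0 m0 :: real
  assumes y0_D: "y0 \<in> D" and \<theta>: "\<theta> > 1" and M0_ge: "M0 \<ge> m0" and m0_pos: "m0 > 0"
begin

lemma M0_pos: "M0 > 0" using M0_ge m0_pos by simp

abbreviation "lamB \<equiv> lam_budget \<theta> (M_bar P)"
abbreviation "mB \<equiv> m_budget (m_bar P)"
abbreviation "pair S j \<equiv> sub_pair P \<theta> y0 S j"
abbreviation "accepts S p \<equiv> sub_accepts P y0 S p"

lemma cond_i_fails:
  assumes "valid_state S" "\<not> cond_i P S lam m" "lam > 0"
  shows "0 < C_trial P S lam m" "C_trial P S lam m \<le> M_bar P" "lam * M_bar P > 9/10"
proof -
  have C: "lam * C_trial P S lam m > 9/10" using assms(2) unfolding cond_i_def by simp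
  then have "0 < lam * C_trial P S lam m" by linarith
  then show "0 < C_trial P S lam m" using assms(3) by (simp add: zero_less_mult_iff)
  show le: "C_trial P S lam m \<le> M_bar P"
    by (intro C_trial_le tilde_in_\<Omega>(1) assms(1))
  show "lam * M_bar P > 9/10"
    using C mult_left_mono[OF le, of lam] assms(3) by linarith
qed

text \<open>Since \<open>coef_a S\<close> is at least 2, subtracting \<open>lam / coef_a S\<close>
  from \<open>st_lam S\<close> leaves at least \<open>lam / 2\<close>. The first conclusion, with
  \<open>m_bar\<close> in place of \<open>m_lower\<close>, is what part (b) uses.\<close>

lemma cond_ii_holds:
  assumes "valid_state S" "0 < lam" "lam \<le> st_lam S" "m_bar P \<le> m"
  shows "m_bar P * lam \<le> 2 * m * (st_lam S - lam / coef_a S)" "cond_ii P y0 S lam m"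
proof -
  have a: "coef_a S \<ge> 2" using assms(1) coef_a_ge_2 unfolding valid_state_def by blast
  have m: "m > 0" using assms(4) m_bar_pos by simp
  have "m_bar P * lam \<le> m * lam" using assms by (intro mult_right_mono) auto
  also have "\<dots> = 2 * m * (lam - lam / 2)" by (simp add: algebra_simps)
  also have "\<dots> \<le> 2 * m * (st_lam S - lam / coef_a S)"
    using a assms m by (intro mult_left_mono diff_mono divide_left_mono) auto
  finally show 1: "m_bar P * lam \<le> 2 * m * (st_lam S - lam / coef_a S)" .
  have "m_lower P y0 S * lam \<le> m_bar P * lam"
    using y0_D D_\<Omega> assms(2)
    by (intro mult_right_mono m_lower_le tilde_in_\<Omega>(1)[OF assms(1)] tilde_in_\<Omega>(2)[OF assms(1)]) auto
  then show "cond_ii P y0 S lam m" unfolding cond_ii_def using 1 by simp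
qed

text \<open>The invariant of SUB. A rejected \<open>lam\<close> exceeds 0.9 / \<open>M_bar\<close>,
  and 0.9 / \<open>C_trial\<close> is at least that large, so one reduction cannot go below the
  stated minimum. Similarly \<open>m\<close> is doubled only while it is below
  \<open>m_bar\<close>.\<close>

definition pair_ok :: "'a fista_state \<Rightarrow> real \<times> real \<Rightarrow> bool" where
  "pair_ok S p \<longleftrightarrow> 0 < fst p \<and> fst p \<le> st_lam S \<and> st_m S \<le> snd p
    \<and> min (st_lam S) (9/10 / (\<theta> * M_bar P)) \<le> fst p \<and> snd p \<le> max (st_m S) (2 * m_bar P)"

text \<open>Rejection means that (i) or (ii) fails, and each failing condition lowers its own budget
  by at least 1. Budgets are nonnegative, so the number of rejections is bounded.\<close>

lemma sub_update_ok:
  assumes S: "valid_state S" and ok: "pair_ok S p" and rej: "\<not> accepts S p"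
  defines "q \<equiv> sub_update P \<theta> y0 S p"
  shows "pair_ok S q" "lamB (fst q) + mB (snd q) + 1 \<le> lamB (fst p) + mB (snd p)"
proof -
  obtain lam m where p: "p = (lam, m)" by fastforce
  obtain lam' m' where q': "q = (lam', m')" by fastforce
  note ok' = ok[unfolded pair_ok_def p fst_conv snd_conv]
  have lam: "0 < lam" "lam \<le> st_lam S" and m: "0 < m" using ok' S unfolding valid_state_def by auto
  have lam': "lam' = (if cond_i P S lam m then lam else min (lam / \<theta>) ((9/10) / C_trial P S lam m))"
    and m': "m' = (if cond_ii P y0 S lam m then m else 2 * m)"
    using q' unfolding q_def p by auto
  have L: "0 < lam' \<and> lam' \<le> lam \<and> min (st_lam S) (9/10 / (\<theta> * M_bar P)) \<le> lam'
     \<and> lamB lam' + (if cond_i P S lam m then 0 else 1) \<le> lamB lam"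
  proof (cases "cond_i P S lam m")
    case True
    then show ?thesis using lam ok' unfolding lam' by auto
  next
    case False
    note c = cond_i_fails[OF S False lam(1)]
    have l0: "0 < lam'" using False c lam \<theta> unfolding lam' by simp
    have l1: "lam' \<le> lam / \<theta>" using False unfolding lam' by simp
    have "lam / \<theta> \<le> lam" using lam \<theta> by (simp add: pos_divide_le_eq)
    have "9/10 / (\<theta> * M_bar P) \<le> lam / \<theta>"
      using c(3) \<theta> M_bar_pos lam by (simp add: field_simps)
    moreover have "9/10 / (\<theta> * M_bar P) \<le> 9/10 / C_trial P S lam m"
    proof (rule divide_left_mono)
      have "1 * M_bar P \<le> \<theta> * M_bar P" using \<theta> M_bar_pos by (intro mult_right_mono) auto
      then show "C_trial P S lam m \<le> \<theta> * M_bar P" using c(2) by simp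
    qed (use c \<theta> M_bar_pos in auto)
    ultimately have "9/10 / (\<theta> * M_bar P) \<le> lam'" using False unfolding lam' by simp
    moreover have "lamB lam' + 1 \<le> lamB lam"
      by (rule lam_budget_decrease[OF \<theta> M_bar_pos l0 l1 c(3)])
    ultimately show ?thesis using False l0 l1 \<open>lam / \<theta> \<le> lam\<close> by simp
  qed
  have R: "st_m S \<le> m' \<and> m' \<le> max (st_m S) (2 * m_bar P)
     \<and> mB m' + (if cond_ii P y0 S lam m then 0 else 1) \<le> mB m"
  proof (cases "cond_ii P y0 S lam m")
    case True
    then show ?thesis using ok' unfolding m' by auto
  next
    case False
    then have "m < m_bar P" using cond_ii_holds(2)[OF S lam, of m] by (meson not_le)
    then show ?thesis using False ok' m m_budget_decrease[of m "m_bar P"] unfolding m' by auto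
  qed
  show "pair_ok S q" using L R lam unfolding pair_ok_def q' by auto
  show "lamB (fst q) + mB (snd q) + 1 \<le> lamB (fst p) + mB (snd p)"
    using L R rej unfolding q' p by (auto split: if_splits)
qed

lemma sub_pair_ok:
  assumes S: "valid_state S" and "\<And>i. i < j \<Longrightarrow> \<not> accepts S (pair S i)"
  shows "pair_ok S (pair S j)
    \<and> lamB (fst (pair S j)) + mB (snd (pair S j)) + real j \<le> lamB (st_lam S) + mB (st_m S)"
  using assms(2)
proof (induction j)
  case 0
  then show ?case using S unfolding pair_ok_def sub_pair_def valid_state_def by simp
next
  case (Suc j)
  have "pair S (Suc j) = sub_update P \<theta> y0 S (pair S j)" unfolding sub_pair_def by simp
  then show ?case
    using sub_update_ok[OF S, of "pair S j"] Suc.IH Suc.prems by force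
qed

lemma sub_terminates: "valid_state S \<Longrightarrow> sub_terminates P \<theta> y0 S"
proof (rule ccontr)
  assume S: "valid_state S" and "\<not> sub_terminates P \<theta> y0 S"
  then have n: "\<not> accepts S (pair S i)" for i unfolding sub_terminates_def by blast
  obtain j :: nat where "lamB (st_lam S) + mB (st_m S) < real j" using reals_Archimedean2 by blast
  moreover have "0 \<le> lamB (fst (pair S j))" "0 \<le> mB (snd (pair S j))"
    unfolding lam_budget_def m_budget_def by auto
  ultimately show False using sub_pair_ok[OF S, of j] n by force
qed

lemma sub_result:
  assumes S: "valid_state S"
  defines "p \<equiv> pair S (sub_last P \<theta> y0 S)"
  shows "accepts S p" "pair_ok S p"
    "lamB (fst p) + mB (snd p) + real (sub_last P \<theta> y0 S) \<le> lamB (st_lam S) + mB (st_m S)"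
proof -
  have ex: "\<exists>j. accepts S (pair S j)" using sub_terminates[OF S] unfolding sub_terminates_def .
  show "accepts S p" unfolding p_def sub_last_def by (rule LeastI_ex[OF ex])
  have "\<not> accepts S (pair S i)" if "i < sub_last P \<theta> y0 S" for i
    using that unfolding sub_last_def by (rule not_less_Least)
  from sub_pair_ok[OF S this]
  show "pair_ok S p" "lamB (fst p) + mB (snd p) + real (sub_last P \<theta> y0 S) \<le> lamB (st_lam S) + mB (st_m S)"
    unfolding p_def by auto
qed

section \<open>The generated sequence of states\<close>

abbreviation "next_state S \<equiv> fista_step P \<theta> y0 S"

lemma fista_step_fields:
  fixes S
  defines "lam \<equiv> st_lam (next_state S)" and "m \<equiv> st_m (next_state S)"
  shows "(lam, m) = pair S (sub_last P \<theta> y0 S)"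
    "st_y (next_state S) = y_trial P S lam m"
    "st_x (next_state S) = proj_region P ((1 / (2 * m * lam + 1)) *\<^sub>R
       ((coef_a S + 2 * m * lam) *\<^sub>R y_trial P S lam m - (coef_a S - 1) *\<^sub>R st_y S))"
    "st_A (next_state S) = A_next S"
    "st_v (next_state S) = prox_coef S lam m *\<^sub>R (x_tilde S - y_trial P S lam m)
       + grad P (y_trial P S lam m) - grad P (x_tilde S)"
  unfolding lam_def m_def fista_step_def prox_coef_def
  by (simp_all add: Let_def case_prod_unfold)

lemma fista_step_valid:
  assumes S: "valid_state S"
  shows "valid_state (next_state S)" "pair_ok S (st_lam (next_state S), st_m (next_state S))"
    "cond_i P S (st_lam (next_state S)) (st_m (next_state S))"
    "cond_ii P y0 S (st_lam (next_state S)) (st_m (next_state S))"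
proof -
  note r = sub_result[OF S, folded fista_step_fields(1)]
  show ok: "pair_ok S (st_lam (next_state S), st_m (next_state S))" by (rule r(2))
  show "cond_i P S (st_lam (next_state S)) (st_m (next_state S))"
    "cond_ii P y0 S (st_lam (next_state S)) (st_m (next_state S))" using r(1) by auto
  have "2 \<le> A_next S" using S coef_a_ge_2[of S] unfolding A_next_def valid_state_def by auto
  then show "valid_state (next_state S)"
    using S ok y_trial_D proj_region_in
    unfolding valid_state_def pair_ok_def fista_step_fields(2-4) by auto
qed

abbreviation "St k \<equiv> fista P \<theta> y0 M0 m0 k"

lemma St_0: "St 0 = fista_init y0 M0 m0" and St_Suc: "St (Suc k) = next_state (St k)"
  unfolding fista_def by simp_all

lemma St_valid: "valid_state (St k)"
proof (induction k)
  case 0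
  show ?case unfolding St_0 fista_init_def valid_state_def using y0_D D_\<Omega> M0_pos m0_pos by auto
next
  case (Suc k)
  then show ?case unfolding St_Suc by (rule fista_step_valid)
qed

lemma St_pair_ok: "pair_ok (St k) (st_lam (St (Suc k)), st_m (St (Suc k)))"
  unfolding St_Suc by (rule fista_step_valid(2)[OF St_valid])

text \<open>The relative bounds in \<open>pair_ok\<close> do not accumulate over the outer
  iterations, because taking the minimum or maximum with the same threshold repeatedly changes
  nothing.\<close>

lemma St_bounds:
  "st_lam (St k) \<le> 1 / M0" "min (1 / M0) (9/10 / (\<theta> * M_bar P)) \<le> st_lam (St k)"
  "m0 \<le> st_m (St k)" "st_m (St k) \<le> max m0 (2 * m_bar P)"
proof -
  have "st_lam (St k) \<le> 1 / M0 \<and> min (1 / M0) (9/10 / (\<theta> * M_bar P)) \<le> st_lam (St k)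
    \<and> m0 \<le> st_m (St k) \<and> st_m (St k) \<le> max m0 (2 * m_bar P)"
  proof (induction k)
    case 0
    show ?case unfolding St_0 fista_init_def by simp
  next
    case (Suc k)
    show ?case using Suc.IH St_pair_ok[of k] unfolding pair_ok_def by auto
  qed
  then show "st_lam (St k) \<le> 1 / M0" "min (1 / M0) (9/10 / (\<theta> * M_bar P)) \<le> st_lam (St k)"
    "m0 \<le> st_m (St k)" "st_m (St k) \<le> max m0 (2 * m_bar P)" by auto
qed

lemma sum_sub_passes:
  "real (\<Sum>k<T. sub_passes P \<theta> y0 (St k)) \<le> real T + (lamB (1 / M0) + mB m0)"
proof -
  \<comment> \<open>The budgets left after \<open>T\<close> calls are kept on the left: each call of
    SUB starts from the pair where the previous one stopped, so rejections are charged to a single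
    initial budget.\<close>
  have "real (\<Sum>k<T. sub_passes P \<theta> y0 (St k)) + lamB (st_lam (St T)) + mB (st_m (St T))
     \<le> real T + (lamB (1 / M0) + mB m0)"
  proof (induction T)
    case 0
    show ?case unfolding St_0 fista_init_def by simp
  next
    case (Suc T)
    have "lamB (st_lam (St (Suc T))) + mB (st_m (St (Suc T))) + real (sub_last P \<theta> y0 (St T))
       \<le> lamB (st_lam (St T)) + mB (st_m (St T))"
      using sub_result(3)[OF St_valid, folded fista_step_fields(1)] unfolding St_Suc by simp
    then show ?case using Suc.IH unfolding sub_passes_def by simp
  qed
  moreover have "0 \<le> lamB (st_lam (St T))" "0 \<le> mB (st_m (St T))"
    unfolding lam_budget_def m_budget_def by auto
  ultimately show ?thesis by linarith
qed

lemma stationary_iterate: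
  assumes "k \<ge> 1"
  shows "stationary_pair P (st_y (St k)) (st_v (St k))"
proof -
  obtain j where "k = Suc j" using assms by (cases k) auto
  show ?thesis
    unfolding \<open>k = Suc j\<close> St_Suc fista_step_fields(2,5)
    by (rule y_trial_stationary[OF tilde_in_\<Omega>(1)[OF St_valid]])
qed


section \<open>Outer iterations\<close>

text \<open>The estimates \<open>2 * a \<le> sqrt (1 + 4 * a\<^sup>2) \<le> 1 + 2 * a\<close> make
  each increment of \<open>coef_a\<close> lie between 1/2 and 1.\<close>

lemma coef_a_St: "coef_a (St k) \<ge> 2 + real k / 2" "coef_a (St k) \<le> real k + 2"
proof -
  have "2 + real k / 2 \<le> coef_a (St k) \<and> coef_a (St k) \<le> real k + 2"
  proof (induction k)
    case 0
    show ?case unfolding St_0 fista_init_def coef_a_def by simp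
  next
    case (Suc k)
    define a where "a = coef_a (St k)"
    have a: "0 \<le> a" using Suc unfolding a_def by simp
    have "st_A (St (Suc k)) = a\<^sup>2"
      using A_next_eq[of "St k"] St_valid[of k] unfolding St_Suc fista_step_fields(4) a_def valid_state_def by simp
    then have e: "coef_a (St (Suc k)) = (1 + sqrt (1 + 4 * a\<^sup>2)) / 2"
      unfolding coef_a_def by simp
    have "2 * a \<le> sqrt (1 + 4 * a\<^sup>2)" by (rule real_le_rsqrt) (simp add: power_mult_distrib)
    moreover have "sqrt (1 + 4 * a\<^sup>2) \<le> 1 + 2 * a"
      using a by (intro real_le_lsqrt) (auto simp: power2_eq_square algebra_simps)
    ultimately show ?case using Suc unfolding e a_def by (auto simp: field_simps)
  qed
  then show "coef_a (St k) \<ge> 2 + real k / 2" "coef_a (St k) \<le> real k + 2" by auto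
qed

definition gap :: "nat \<Rightarrow> real" where
  "gap k = norm (x_tilde (St k) - st_y (St (Suc k)))"

definition potential :: "'a \<Rightarrow> nat \<Rightarrow> real" where
  "potential u k = st_lam (St k) / st_m (St k) * st_A (St k) * (\<phi> (st_y (St k)) - \<phi>_min)
     + (1 / (2 * st_m (St k)) + st_lam (St k)) * (norm (u - st_x (St k)))\<^sup>2"

lemma potential_nonneg: "0 \<le> potential u k"
  using St_valid[of k] \<phi>_ge unfolding potential_def valid_state_def
  by (intro add_nonneg_nonneg mult_nonneg_nonneg) auto

text \<open>The Lipschitz bound handles the gradient difference; the range of \<open>lam\<close> and
  \<open>m\<close> bounds \<open>prox_coef\<close>. The factor 10/9 from the threshold 0.9 is
  rounded up to 2.\<close>

lemma residual_le_gap: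
  "norm (st_v (St (Suc k))) \<le> (2 * \<theta> + 3) * (M0 + M_bar P) * gap k"
proof -
  define lam m y a where lmy: "lam = st_lam (St (Suc k))" "m = st_m (St (Suc k))"
    "y = st_y (St (Suc k))" "a = coef_a (St k)"
  have a: "a \<ge> 2" unfolding lmy using coef_a_St(1)[of k] by simp
  have yD: "y \<in> D" and lam: "lam > 0" and m: "m > 0"
    using St_valid[of "Suc k"] unfolding lmy valid_state_def by auto
  have M: "M_bar P > 0" by (rule M_bar_pos)
  have "st_v (St (Suc k)) = prox_coef (St k) lam m *\<^sub>R (x_tilde (St k) - y)
      + (grad P y - grad P (x_tilde (St k)))"
    unfolding lmy St_Suc fista_step_fields(2,5) by simp
  also have "norm \<dots> \<le> prox_coef (St k) lam m * norm (x_tilde (St k) - y)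
      + M_bar P * norm (y - x_tilde (St k))"
  proof (rule order_trans[OF norm_triangle_ineq add_mono])
    show "norm (prox_coef (St k) lam m *\<^sub>R (x_tilde (St k) - y)) \<le> prox_coef (St k) lam m * norm (x_tilde (St k) - y)"
      using lam m a unfolding prox_coef_def lmy(4) by simp
    show "norm (grad P y - grad P (x_tilde (St k))) \<le> M_bar P * norm (y - x_tilde (St k))"
      using lipschitz_M_bar tilde_in_\<Omega>(1)[OF St_valid[of k]] yD D_\<Omega> unfolding lipschitz_grad_def by auto
  qed
  also have "\<dots> = (prox_coef (St k) lam m + M_bar P) * gap k"
    unfolding gap_def lmy by (simp add: algebra_simps norm_minus_commute)
  also have "\<dots> \<le> (2 * \<theta> + 3) * (M0 + M_bar P) * gap k"
  proof (rule mult_right_mono)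
    have "1 / lam \<le> M0 + 2 * \<theta> * M_bar P"
    proof (cases "1 / M0 \<le> 9/10 / (\<theta> * M_bar P)")
      case True
      then have "1 / M0 \<le> lam" using St_bounds(2)[of "Suc k"] unfolding lmy by simp
      then have "1 / lam \<le> M0" using lam M0_pos by (simp add: field_simps)
      then show ?thesis using \<theta> M by (smt (verit) mult_nonneg_nonneg)
    next
      case False
      then have "9/10 / (\<theta> * M_bar P) \<le> lam" using St_bounds(2)[of "Suc k"] unfolding lmy by simp
      then have "9/10 / lam \<le> \<theta> * M_bar P" using lam M \<theta> by (simp add: field_simps)
      moreover have "9/10 / lam = 9/10 * (1 / lam)" by simp
      moreover have "0 < \<theta> * M_bar P" using \<theta> M by simp
      ultimately have "1 / lam \<le> M0 + 2 * (\<theta> * M_bar P)" using M0_pos by linarith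
      then show ?thesis by (simp add: mult.assoc)
    qed
    moreover have "2 * m / a \<le> M0 + 2 * M_bar P"
    proof -
      have "2 * m / a \<le> m" using a m by (simp add: pos_divide_le_eq mult.commute)
      also have "\<dots> \<le> max m0 (2 * m_bar P)" using St_bounds(4) unfolding lmy by blast
      also have "\<dots> \<le> M0 + 2 * M_bar P" using M0_ge m0_pos m_bar_le_M_bar m_bar_pos by auto
      finally show ?thesis .
    qed
    moreover have "0 \<le> \<theta> * M0" using \<theta> M0_pos by simp
    ultimately show "prox_coef (St k) lam m + M_bar P \<le> (2 * \<theta> + 3) * (M0 + M_bar P)"
      unfolding prox_coef_def lmy(4)[symmetric] using M0_pos by (simp add: algebra_simps)
  qed (simp add: gap_def)
  finally show ?thesis .
qed

text \<open>The last hypothesis is condition (ii) with \<mu> in place of \<open>m_lower\<close>. It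
  makes the coefficient of the old distance at most \<open>1 + 2 * m' * lam\<close>, which after
  division by \<open>2 * m'\<close> fits the potential.\<close>

lemma potential_step:
  assumes u: "u \<in> D"
    and \<mu>: "lin_f P (y_tilde u (St k)) (x_tilde (St k)) - f (y_tilde u (St k))
              \<le> \<mu> / 2 * (norm (y_tilde u (St k) - x_tilde (St k)))\<^sup>2"
    and ii: "\<mu> * st_lam (St (Suc k))
        \<le> 2 * st_m (St (Suc k)) * (st_lam (St k) - st_lam (St (Suc k)) / coef_a (St k))"
  shows "potential u (Suc k) + (coef_a (St k))\<^sup>2 / (20 * st_m (St (Suc k))) * (gap k)\<^sup>2
    \<le> potential u k + coef_a (St k) * (\<phi> u - \<phi>_min + m_bar P / 2 * (D_h P)\<^sup>2) / (M0 * m0) + (D_h P)\<^sup>2 / M0"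
proof -
  define lam m lam' m' a A where d: "lam = st_lam (St k)" "m = st_m (St k)"
    "lam' = st_lam (St (Suc k))" "m' = st_m (St (Suc k))" "a = coef_a (St k)" "A = st_A (St k)"
  define \<delta> \<delta>' \<delta>u where \<delta>: "\<delta> = \<phi> (st_y (St k)) - \<phi>_min" "\<delta>' = \<phi> (st_y (St (Suc k))) - \<phi>_min"
    "\<delta>u = \<phi> u - \<phi>_min"
  define N R R' G where NR: "N = (gap k)\<^sup>2" "R = (norm (u - st_x (St k)))\<^sup>2"
    "R' = (norm (u - st_x (St (Suc k))))\<^sup>2" "G = \<delta>u + m_bar P / 2 * (D_h P)\<^sup>2"
  have pos: "0 < lam" "0 < m" "0 < lam'" "0 < m'" and A2: "A \<ge> 2"
    using St_valid[of k] St_valid[of "Suc k"] unfolding d valid_state_def by auto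
  have mono: "lam' \<le> lam" "m \<le> m'" using St_pair_ok[of k] unfolding pair_ok_def d by auto
  have a: "a \<ge> 2" unfolding d using coef_a_St(1)[of k] by simp
  have Aa: "a\<^sup>2 = A + a" unfolding d using coef_a_square[of "St k"] A2[unfolded d] by simp
  have \<delta>_nn: "0 \<le> \<delta>" "0 \<le> \<delta>'" "0 \<le> \<delta>u"
    using \<phi>_ge u St_valid[of k] St_valid[of "Suc k"] unfolding \<delta> valid_state_def by auto
  have G: "0 \<le> G" unfolding NR using \<delta>_nn m_bar_pos by simp
  have A': "st_A (St (Suc k)) = a\<^sup>2"
    using A_next_eq[of "St k"] A2 unfolding St_Suc fista_step_fields(4) d by simp
  have i: "cond_i P (St k) lam' m'"
    unfolding d St_Suc by (rule fista_step_valid(3)[OF St_valid])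
  have st: "2 * lam' * a\<^sup>2 * (\<delta>' + \<phi>_min) + a\<^sup>2 / 10 * N + (1 + 2 * m' * lam') * R'
      \<le> 2 * lam' * (A * (\<delta> + \<phi>_min) + a * (\<delta>u + \<phi>_min)) + (lam' * m_bar P * a + 2 * m' * lam') * (D_h P)\<^sup>2
        + (1 + 2 * m' * lam' / a + lam' * \<mu>) * R"
    using one_step[OF St_valid pos(3,4) u i \<mu>]
    unfolding \<delta> NR gap_def unfolding d St_Suc fista_step_fields(2,3) by simp
  also have "(1 + 2 * m' * lam' / a + lam' * \<mu>) * R \<le> (1 + 2 * m' * lam) * R"
  proof (rule mult_right_mono)
    show "1 + 2 * m' * lam' / a + lam' * \<mu> \<le> 1 + 2 * m' * lam"
      using ii unfolding d[symmetric] by (simp add: algebra_simps)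
  qed (simp add: NR)
  \<comment> \<open>The \<open>\<phi>_min\<close> terms cancel because of
    \<open>a\<^sup>2 = A + a\<close>; the curvature error linear in \<open>a\<close> is collected in
    \<open>G\<close>.\<close>
  finally have "2 * lam' * a\<^sup>2 * \<delta>' + a\<^sup>2 / 10 * N + (1 + 2 * m' * lam') * R'
      \<le> 2 * lam' * (A * \<delta> + a * G) + 2 * m' * lam' * (D_h P)\<^sup>2 + (1 + 2 * m' * lam) * R"
    unfolding Aa NR(4) by (simp add: algebra_simps)
  then have "(2 * lam' * a\<^sup>2 * \<delta>' + a\<^sup>2 / 10 * N + (1 + 2 * m' * lam') * R') / (2 * m')
      \<le> (2 * lam' * (A * \<delta> + a * G) + 2 * m' * lam' * (D_h P)\<^sup>2 + (1 + 2 * m' * lam) * R) / (2 * m')"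
    using pos by (intro divide_right_mono) auto
  then have "lam' / m' * a\<^sup>2 * \<delta>' + a\<^sup>2 / (20 * m') * N + (1 / (2 * m') + lam') * R'
      \<le> lam' / m' * (A * \<delta>) + lam' / m' * (a * G) + lam' * (D_h P)\<^sup>2 + (1 / (2 * m') + lam) * R"
    using pos by (simp add: add_divide_distrib distrib_left distrib_right)
  \<comment> \<open>Here \<open>lam\<close> decreasing and \<open>m\<close> increasing restore the
    potential at \<open>k\<close>, and the uniform bounds on both make the error coefficients
    independent of \<open>k\<close>.\<close>
  also have "\<dots> \<le> lam / m * (A * \<delta>) + 1 / (M0 * m0) * (a * G) + 1 / M0 * (D_h P)\<^sup>2 + (1 / (2 * m) + lam) * R"
  proof (intro add_mono mult_right_mono)
    show "lam' / m' \<le> lam / m" using pos mono by (intro frac_le) auto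
    have "lam' / m' \<le> (1 / M0) / m0"
      using pos St_bounds(1,3)[of "Suc k"] M0_pos m0_pos unfolding d by (intro frac_le) auto
    then show "lam' / m' \<le> 1 / (M0 * m0)" by simp
    show "lam' \<le> 1 / M0" using St_bounds(1) unfolding d by blast
    show "1 / (2 * m') \<le> 1 / (2 * m)" using pos mono by (intro frac_le) auto
  qed (use A2 \<delta>_nn a G in \<open>auto simp: NR\<close>)
  finally show ?thesis
    unfolding potential_def A' d[symmetric] \<delta>[symmetric] NR[symmetric] by (simp add: mult.assoc)
qed

text \<open>The summed potential inequality, common to (a) and (b). \<kappa> measures how far
  \<open>m\<close> can grow beyond \<open>2 * m0\<close>.\<close>

lemma complexity_bound:
  assumes u: "u \<in> D" and \<rho>: "\<rho> > 0"
    and \<mu>: "\<And>k. lin_f P (y_tilde u (St k)) (x_tilde (St k)) - f (y_tilde u (St k))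
              \<le> \<mu> k / 2 * (norm (y_tilde u (St k) - x_tilde (St k)))\<^sup>2"
    and ii: "\<And>k. \<mu> k * st_lam (St (Suc k))
        \<le> 2 * st_m (St (Suc k)) * (st_lam (St k) - st_lam (St (Suc k)) / coef_a (St k))"
    and m: "\<And>k. st_m (St k) \<le> 2 * m0 * \<kappa>"
    and \<rho>_lt: "\<And>i. 1 \<le> i \<Longrightarrow> i \<le> n \<Longrightarrow> \<rho> < norm (st_v (St i))"
  defines "c \<equiv> 2 * \<theta> + 3"
  shows "real n ^ 3 \<le> 960 * c\<^sup>2 * (\<kappa> * C_2 P M0 * M_bar P / \<rho>\<^sup>2) *
    (primal_gap P y0 + M0 * (norm (u - y0))\<^sup>2 + (real n)\<^sup>2 * (\<phi> u - \<phi>_min + m_bar P * (D_h P)\<^sup>2)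
      + real n * (m0 * (D_h P)\<^sup>2))"
proof -
  have M: "M_bar P > 0" by (rule M_bar_pos)
  have c: "c > 0" unfolding c_def using \<theta> by simp
  have "0 < 2 * m0 * \<kappa>" using m[of 0] St_valid[of 0] unfolding valid_state_def by linarith
  then have \<kappa>: "\<kappa> > 0" using m0_pos by (simp add: zero_less_mult_iff)
  define r where "r = \<rho>\<^sup>2 / (c * (M0 + M_bar P))\<^sup>2"
  define G where "G = \<phi> u - \<phi>_min + m_bar P / 2 * (D_h P)\<^sup>2"
  have r: "r > 0" unfolding r_def using \<rho> c M M0_pos by simp
  have G: "G \<ge> 0" unfolding G_def using \<phi>_ge[OF u] m_bar_pos by simp
  have gap: "r \<le> (gap k)\<^sup>2" if "k < n" for k
  proof -
    have "\<rho> \<le> c * (M0 + M_bar P) * gap k"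
      using \<rho>_lt[of "Suc k"] that residual_le_gap[of k] unfolding c_def by simp
    then have "\<rho>\<^sup>2 \<le> (c * (M0 + M_bar P) * gap k)\<^sup>2" using \<rho> by (intro power_mono) auto
    then show ?thesis unfolding r_def using c M M0_pos
      by (subst pos_divide_le_eq) (auto simp: power_mult_distrib mult.commute)
  qed
  \<comment> \<open>The constant is 480 = 3 * 4 * 40: 3 from the difference of consecutive cubes, 4
    from \<open>(k + 4)\<^sup>2 / 4\<close> below the square of \<open>coef_a\<close>, and 40 from
    \<open>20 * st_m\<close> with \<open>st_m\<close> at most
    \<open>2 * m0 * \<kappa>\<close>.\<close>
  define t where "t = r / (480 * m0 * \<kappa>)"
  have t: "t > 0" unfolding t_def using r m0_pos \<kappa> by simp
  have "potential u k + t * real k ^ 3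
    \<le> potential u 0 + 2 * (real k)\<^sup>2 * (G / (M0 * m0)) + real k * ((D_h P)\<^sup>2 / M0)" if "k \<le> n" for k
    using that
  proof (induction k)
    case 0
    then show ?case by simp
  next
    case (Suc k)
    have "t * (real (Suc k) ^ 3 - real k ^ 3) \<le> (coef_a (St k))\<^sup>2 / (20 * st_m (St (Suc k))) * (gap k)\<^sup>2"
    proof -
      have "(2 + real k / 2)\<^sup>2 \<le> (coef_a (St k))\<^sup>2"
        using coef_a_St(1) by (intro power_mono) auto
      then have "(real k + 4)\<^sup>2 / 4 \<le> (coef_a (St k))\<^sup>2" by (simp add: power2_eq_square algebra_simps)
      then have "(real k + 4)\<^sup>2 / 4 / (20 * (2 * m0 * \<kappa>)) * r
        \<le> (coef_a (St k))\<^sup>2 / (20 * st_m (St (Suc k))) * (gap k)\<^sup>2"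
        using m[of "Suc k"] gap[of k] Suc.prems St_valid[of "Suc k"] r unfolding valid_state_def
        by (intro mult_mono frac_le) auto
      moreover have "t * (real (Suc k) ^ 3 - real k ^ 3) \<le> t * (3 * (real k + 4)\<^sup>2)"
        using t by (intro mult_left_mono) (auto simp: power2_eq_square power3_eq_cube algebra_simps)
      moreover have "t * (3 * (real k + 4)\<^sup>2) = (real k + 4)\<^sup>2 / 4 / (20 * (2 * m0 * \<kappa>)) * r"
        unfolding t_def by (simp add: mult_ac)
      ultimately show ?thesis by linarith
    qed
    moreover have "coef_a (St k) * (G / (M0 * m0)) \<le> (2 * (real (Suc k))\<^sup>2 - 2 * (real k)\<^sup>2) * (G / (M0 * m0))"
      using coef_a_St(2)[of k] G M0_pos m0_pos
      by (intro mult_right_mono) (auto simp: power2_eq_square algebra_simps)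
    moreover note potential_step[OF u \<mu> ii, of k, folded G_def] Suc
    ultimately show ?case by (simp add: algebra_simps add_divide_distrib)
  qed
  from this[of n] have "t * real n ^ 3
    \<le> potential u 0 + 2 * (real n)\<^sup>2 * (G / (M0 * m0)) + real n * ((D_h P)\<^sup>2 / M0)"
    using potential_nonneg[of u n] by simp
  also have "potential u 0 = 2 * primal_gap P y0 / (M0 * m0) + (1 / (2 * m0) + 1 / M0) * (norm (u - y0))\<^sup>2"
    unfolding potential_def St_0 fista_init_def primal_gap_eq[OF y0_D] by simp
  finally have "M0 * m0 * (t * real n ^ 3) \<le> M0 * m0 * (2 * primal_gap P y0 / (M0 * m0)
     + (1 / (2 * m0) + 1 / M0) * (norm (u - y0))\<^sup>2 + 2 * (real n)\<^sup>2 * (G / (M0 * m0)) + real n * ((D_h P)\<^sup>2 / M0))"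
    using M0_pos m0_pos by (intro mult_left_mono) auto
  also have "\<dots> = 2 * primal_gap P y0 + (M0 / 2 + m0) * (norm (u - y0))\<^sup>2 + 2 * (real n)\<^sup>2 * G
     + real n * (m0 * (D_h P)\<^sup>2)"
    using M0_pos m0_pos by (simp add: field_simps)
  also have "\<dots> \<le> 2 * (primal_gap P y0 + M0 * (norm (u - y0))\<^sup>2
     + (real n)\<^sup>2 * (\<phi> u - \<phi>_min + m_bar P * (D_h P)\<^sup>2) + real n * (m0 * (D_h P)\<^sup>2))" (is "_ \<le> 2 * ?B")
  proof -
    have "(M0 / 2 + m0) * (norm (u - y0))\<^sup>2 \<le> 2 * (M0 * (norm (u - y0))\<^sup>2)"
      using M0_ge M0_pos mult_right_mono[of "M0 / 2 + m0" "2 * M0" "(norm (u - y0))\<^sup>2"] by simp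
    moreover have "(real n)\<^sup>2 * G \<le> (real n)\<^sup>2 * (\<phi> u - \<phi>_min + m_bar P * (D_h P)\<^sup>2)"
      unfolding G_def using m_bar_pos by (intro mult_left_mono) auto
    moreover have "0 \<le> real n * (m0 * (D_h P)\<^sup>2)" using m0_pos by simp
    ultimately show ?thesis unfolding distrib_left[of 2] mult.assoc[of 2] by linarith
  qed
  finally have B: "M0 * m0 * t * real n ^ 3 \<le> 2 * ?B" by (simp add: mult.assoc)
  \<comment> \<open>This identity explains \<open>C_2\<close>: it trades the square of
    \<open>M0 + M_bar P\<close> from the residual estimate for a multiple of \<open>M_bar P\<close>,
    the factor \<open>M0\<close> cancelling against the potential.\<close>
  have C2: "C_2 P M0 * M0 * M_bar P = (M0 + M_bar P)\<^sup>2"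
  proof -
    have "C_2 P M0 = M0 / M_bar P + M_bar P / M0 + 2 * sqrt ((M0 / M_bar P) * (M_bar P / M0))"
      unfolding C_2_def using M M0_pos by (simp add: power2_sum mult.assoc flip: real_sqrt_mult)
    also have "(M0 / M_bar P) * (M_bar P / M0) = 1" using M M0_pos by simp
    finally show ?thesis using M M0_pos by (simp add: field_simps power2_eq_square)
  qed
  define Q where "Q = 480 * c\<^sup>2 * (\<kappa> * C_2 P M0 * M_bar P)"
  have t_eq: "M0 * m0 * t = \<rho>\<^sup>2 / Q"
  proof -
    have "M0 * m0 * t = M0 * \<rho>\<^sup>2 / (480 * \<kappa> * c\<^sup>2 * (M0 + M_bar P)\<^sup>2)"
      unfolding t_def r_def power_mult_distrib using m0_pos by simp
    then show ?thesis unfolding C2[symmetric] Q_def using M0_pos by simp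
  qed
  have "C_2 P M0 > 0"
    using C2 M M0_pos by (smt (verit) zero_less_mult_iff zero_less_power)
  then have Q: "Q > 0" unfolding Q_def using c \<kappa> M by simp
  have "real n ^ 3 = (\<rho>\<^sup>2 / Q * real n ^ 3) * (Q / \<rho>\<^sup>2)" using Q \<rho> by simp
  also have "\<dots> \<le> (2 * ?B) * (Q / \<rho>\<^sup>2)"
    using B unfolding t_eq by (rule mult_right_mono) (use Q in simp)
  also have "\<dots> = 960 * c\<^sup>2 * (\<kappa> * C_2 P M0 * M_bar P / \<rho>\<^sup>2) * ?B"
    unfolding Q_def by simp
  finally show ?thesis .
qed


section \<open>The two iteration bounds and the stopping index\<close>

lemma primal_gap_nonneg: "0 \<le> primal_gap P y0"
  using primal_gap_eq[OF y0_D] \<phi>_ge[OF y0_D] by simp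

text \<open>The choice \<open>u = y0\<close> is the one for which SUB itself checks condition (ii).
  The initial distance term vanishes, while the gap of \<open>u\<close> enters with weight
  \<open>n\<^sup>2\<close>.\<close>

lemma outer_bound:
  assumes \<rho>: "\<rho> > 0" and n: "\<And>i. 1 \<le> i \<Longrightarrow> i \<le> n \<Longrightarrow> \<rho> < norm (st_v (St i))"
  shows "real n \<le> 960 * (2 * \<theta> + 3)\<^sup>2 *
    ((C_1 P M0 m0 * M_bar P * primal_gap P y0 / \<rho>\<^sup>2) powr (1/3)
     + (C_1 P M0 m0 * M_bar P * m0 * (D_h P)\<^sup>2 / \<rho>\<^sup>2) powr (1/2)
     + C_1 P M0 m0 * M_bar P * (m_bar P * (D_h P)\<^sup>2 + primal_gap P y0) / \<rho>\<^sup>2)"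
proof -
  define \<kappa> where "\<kappa> = max (m_bar P / m0) 1"
  define B where "B = \<kappa> * C_2 P M0 * M_bar P / \<rho>\<^sup>2"
  have B: "B \<ge> 0" unfolding B_def \<kappa>_def using C_2_nonneg[of P M0] M_bar_pos by simp
  have q: "960 * (2 * \<theta> + 3)\<^sup>2 \<ge> 1"
    using \<theta> one_le_power[of "2 * \<theta> + 3" 2] by linarith
  have "m0 * 1 \<le> m0 * \<kappa>" "m0 * (m_bar P / m0) \<le> m0 * \<kappa>"
    unfolding \<kappa>_def using m0_pos by (intro mult_left_mono; simp)+
  then have "max m0 (2 * m_bar P) \<le> 2 * m0 * \<kappa>" using m0_pos by simp
  then have m: "st_m (St k) \<le> 2 * m0 * \<kappa>" for k using St_bounds(4)[of k] by linarith
  have ii: "m_lower P y0 (St k) * st_lam (St (Suc k))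
        \<le> 2 * st_m (St (Suc k)) * (st_lam (St k) - st_lam (St (Suc k)) / coef_a (St k))" for k
    using fista_step_valid(4)[OF St_valid[of k]] unfolding St_Suc cond_ii_def .
  note cb = complexity_bound[where n = n, OF y0_D \<rho> m_lower_bound ii m n]
  have "real n ^ 3 \<le> 960 * (2 * \<theta> + 3)\<^sup>2 * (B * primal_gap P y0
      + (real n)\<^sup>2 * (B * (m_bar P * (D_h P)\<^sup>2 + primal_gap P y0)) + real n * (B * (m0 * (D_h P)\<^sup>2)))"
    using cb unfolding B_def[symmetric] primal_gap_eq[OF y0_D, symmetric] by (simp add: algebra_simps)
  then have "real n \<le> 960 * (2 * \<theta> + 3)\<^sup>2 * ((B * primal_gap P y0) powr (1/3)
      + (B * (m0 * (D_h P)\<^sup>2)) powr (1/2) + B * (m_bar P * (D_h P)\<^sup>2 + primal_gap P y0))"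
    using B primal_gap_nonneg m0_pos m_bar_pos
    by (intro cubic_bound[OF _ q]) auto
  moreover have "B = C_1 P M0 m0 * M_bar P / \<rho>\<^sup>2"
    unfolding B_def C_1_def \<kappa>_def by (simp add: mult_ac)
  ultimately show ?thesis by (simp add: mult_ac)
qed

text \<open>Once \<open>m0 \<ge> m_bar P\<close>, condition (ii) holds with \<open>m_bar\<close> at
  every step, so \<open>u\<close> may be any optimal point and its gap vanishes; also \<kappa> is 1.
  The infimum over the optimal set then produces \<open>d_0\<close>.\<close>

lemma outer_bound_large_m0:
  assumes \<rho>: "\<rho> > 0" and n: "\<And>i. 1 \<le> i \<Longrightarrow> i \<le> n \<Longrightarrow> \<rho> < norm (st_v (St i))"
    and m0: "m0 \<ge> m_bar P"
  shows "real n \<le> 960 * (2 * \<theta> + 3)\<^sup>2 *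
    ((C_2 P M0 * M_bar P * (primal_gap P y0 + M0 * (d_0 P y0)\<^sup>2) / \<rho>\<^sup>2) powr (1/3)
     + (C_2 P M0 * M_bar P * m0 * (D_h P)\<^sup>2 / \<rho>\<^sup>2) powr (1/2)
     + C_2 P M0 * M_bar P * m_bar P * (D_h P)\<^sup>2 / \<rho>\<^sup>2)"
proof -
  define B where "B = C_2 P M0 * M_bar P / \<rho>\<^sup>2"
  define q where "q = 960 * (2 * \<theta> + 3)\<^sup>2"
  have q: "q \<ge> 1" unfolding q_def using \<theta> one_le_power[of "2 * \<theta> + 3" 2] by linarith
  have "C_2 P M0 > 0"
    unfolding C_2_def using M_bar_pos M0_pos by (intro zero_less_power add_pos_pos) auto
  then have B: "B > 0" unfolding B_def using M_bar_pos \<rho> by simp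
  have m: "st_m (St k) \<le> 2 * m0 * 1" for k using St_bounds(4)[of k] m0 m0_pos by simp
  have ii: "m_bar P * st_lam (St (Suc k))
        \<le> 2 * st_m (St (Suc k)) * (st_lam (St k) - st_lam (St (Suc k)) / coef_a (St k))" for k
    using St_pair_ok[of k] St_bounds(3)[of "Suc k"] m0 unfolding pair_ok_def
    by (intro cond_ii_holds(1) St_valid) auto
  have "real n ^ 3 \<le> q * (B * primal_gap P y0
      + (real n)\<^sup>2 * (B * (m_bar P * (D_h P)\<^sup>2)) + real n * (B * (m0 * (D_h P)\<^sup>2)))
      + q * B * M0 * (dist y0 u)\<^sup>2" if u: "u \<in> optimal_set P" for u
  proof -
    have uD: "u \<in> D" by (rule optimal_set_D[OF u])
    have curv: "lin_f P (y_tilde u (St k)) (x_tilde (St k)) - f (y_tilde u (St k))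
              \<le> m_bar P / 2 * (norm (y_tilde u (St k) - x_tilde (St k)))\<^sup>2" for k
      using uD D_\<Omega> by (intro curvature_bound tilde_in_\<Omega> St_valid) auto
    show ?thesis
      using complexity_bound[where n = n, OF uD \<rho> curv ii m n] \<phi>_optimal[OF u]
      unfolding mult_1 B_def[symmetric] q_def[symmetric] dist_norm norm_minus_commute[of y0]
      by (simp add: algebra_simps)
  qed
  then have "real n ^ 3 \<le> q * (B * primal_gap P y0
      + (real n)\<^sup>2 * (B * (m_bar P * (D_h P)\<^sup>2)) + real n * (B * (m0 * (D_h P)\<^sup>2)))
      + q * B * M0 * (infdist y0 (optimal_set P))\<^sup>2"
    using q B M0_pos by (intro le_infdist_square[OF optimal_set_nonempty]) auto
  then have "real n ^ 3 \<le> q * (B * (primal_gap P y0 + M0 * (d_0 P y0)\<^sup>2)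
      + (real n)\<^sup>2 * (B * (m_bar P * (D_h P)\<^sup>2)) + real n * (B * (m0 * (D_h P)\<^sup>2)))"
    unfolding d_0_def by (simp add: algebra_simps)
  then have "real n \<le> q * ((B * (primal_gap P y0 + M0 * (d_0 P y0)\<^sup>2)) powr (1/3)
      + (B * (m0 * (D_h P)\<^sup>2)) powr (1/2) + B * (m_bar P * (D_h P)\<^sup>2))"
    using B primal_gap_nonneg M0_pos m0_pos m_bar_pos
    by (intro cubic_bound[OF _ q]) auto
  then show ?thesis unfolding q_def B_def by (simp add: mult_ac)
qed

text \<open>The bound of \<open>outer_bound\<close> does not depend on \<open>n\<close>, so the
  residuals cannot stay above \<rho> forever.\<close>

lemma first_small_residual:
  assumes \<rho>: "\<rho> > 0"
  obtains n where "norm (st_v (St (Suc n))) \<le> \<rho>"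
    "\<And>i. 1 \<le> i \<Longrightarrow> i \<le> n \<Longrightarrow> \<rho> < norm (st_v (St i))"
proof -
  define bd where "bd = 960 * (2 * \<theta> + 3)\<^sup>2 *
    ((C_1 P M0 m0 * M_bar P * primal_gap P y0 / \<rho>\<^sup>2) powr (1/3)
     + (C_1 P M0 m0 * M_bar P * m0 * (D_h P)\<^sup>2 / \<rho>\<^sup>2) powr (1/2)
     + C_1 P M0 m0 * M_bar P * (m_bar P * (D_h P)\<^sup>2 + primal_gap P y0) / \<rho>\<^sup>2)"
  obtain N :: nat where N: "bd < real N" using reals_Archimedean2 by blast
  have "\<exists>j. norm (st_v (St (Suc j))) \<le> \<rho>"
  proof (rule ccontr)
    assume "\<not> ?thesis"
    then have "\<rho> < norm (st_v (St i))" if "1 \<le> i" for i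
      using that by (cases i) (auto simp: not_le)
    from outer_bound[OF \<rho> this, of N] N show False unfolding bd_def by linarith
  qed
  then obtain n where n: "norm (st_v (St (Suc n))) \<le> \<rho>"
    "\<And>j. j < n \<Longrightarrow> \<not> norm (st_v (St (Suc j))) \<le> \<rho>"
    using exists_least_iff[of "\<lambda>j. norm (st_v (St (Suc j))) \<le> \<rho>"] by blast
  have "\<rho> < norm (st_v (St i))" if "1 \<le> i" "i \<le> n" for i
    using n(2)[of "i - 1"] that by (simp add: not_le)
  then show thesis using that n(1) by blast
qed

end

theorem theorem3p4:
  shows "\<exists>K :: real \<Rightarrow> real.
    \<forall>(P :: 'a::real_inner problem) \<theta> y\<^sub>0 M\<^sub>0 m\<^sub>0 \<rho>.
      composite_problem P \<and> y\<^sub>0 \<in> dom_h P \<and> \<theta> > 1 \<and> M\<^sub>0 \<ge> m\<^sub>0 \<and> m\<^sub>0 > 0 \<and> \<rho> > 0 \<longrightarrow>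
      (\<exists>T.
        fista_stops P \<theta> y\<^sub>0 M\<^sub>0 m\<^sub>0 \<rho> T \<and>
        (\<forall>k\<in>{1..T}. stationary_pair P (st_y (fista P \<theta> y\<^sub>0 M\<^sub>0 m\<^sub>0 k)) (st_v (fista P \<theta> y\<^sub>0 M\<^sub>0 m\<^sub>0 k))) \<and>
        approx_solution P \<rho> (st_y (fista P \<theta> y\<^sub>0 M\<^sub>0 m\<^sub>0 T)) (st_v (fista P \<theta> y\<^sub>0 M\<^sub>0 m\<^sub>0 T)) \<and>
        real T \<le> K \<theta> *
          ((C_1 P M\<^sub>0 m\<^sub>0 * M_bar P * primal_gap P y\<^sub>0 / \<rho>\<^sup>2) powr (1/3)
           + (C_1 P M\<^sub>0 m\<^sub>0 * M_bar P * m\<^sub>0 * (D_h P)\<^sup>2 / \<rho>\<^sup>2) powr (1/2)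
           + C_1 P M\<^sub>0 m\<^sub>0 * M_bar P * (m_bar P * (D_h P)\<^sup>2 + primal_gap P y\<^sub>0) / \<rho>\<^sup>2
           + 1) \<and>
        (m\<^sub>0 \<ge> m_bar P \<longrightarrow>
          real T \<le> K \<theta> *
            ((C_2 P M\<^sub>0 * M_bar P * (primal_gap P y\<^sub>0 + M\<^sub>0 * (d_0 P y\<^sub>0)\<^sup>2) / \<rho>\<^sup>2) powr (1/3)
             + (C_2 P M\<^sub>0 * M_bar P * m\<^sub>0 * (D_h P)\<^sup>2 / \<rho>\<^sup>2) powr (1/2)
             + C_2 P M\<^sub>0 * M_bar P * m_bar P * (D_h P)\<^sup>2 / \<rho>\<^sup>2
             + 1)) \<and>
        real (\<Sum>k<T. sub_passes P \<theta> y\<^sub>0 (fista P \<theta> y\<^sub>0 M\<^sub>0 m\<^sub>0 k))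
          \<le> real T + K \<theta> * log1_plus (max (M_bar P / M\<^sub>0) (m_bar P / m\<^sub>0)))"
proof -
  \<comment> \<open>The first summand serves the outer iterations, the second the passes of SUB.
    Only \<theta> enters.\<close>
  define K :: "real \<Rightarrow> real" where "K \<theta> = 960 * (2 * \<theta> + 3)\<^sup>2 + (4 + 2 / ln \<theta>)" for \<theta>
  show ?thesis
  proof (rule exI[of _ K], intro allI impI)
    fix P :: "'a problem" and \<theta> M0 m0 \<rho> :: real and y0 :: 'a
    assume *: "composite_problem P \<and> y0 \<in> dom_h P \<and> \<theta> > 1 \<and> M0 \<ge> m0 \<and> m0 > 0 \<and> \<rho> > 0"
    then interpret fista_run P \<theta> y0 M0 m0 by unfold_locales auto
    have \<rho>: "\<rho> > 0" using * by blast
    obtain n where small: "norm (st_v (St (Suc n))) \<le> \<rho>"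
      and large: "\<And>i. 1 \<le> i \<Longrightarrow> i \<le> n \<Longrightarrow> \<rho> < norm (st_v (St i))"
      by (rule first_small_residual[OF \<rho> that])
    have q0: "960 * (2 * \<theta> + 3)\<^sup>2 \<ge> 0" and k0: "4 + 2 / ln \<theta> \<ge> 1" using \<theta> by simp_all
    \<comment> \<open>The bounds above count the \<open>n\<close> iterates with large residual; the
      stopping iteration \<open>Suc n\<close> is paid for by the \<open>+ 1\<close>.\<close>
    have K1: "real (Suc n) \<le> K \<theta> * (x + 1)"
      if "real n \<le> 960 * (2 * \<theta> + 3)\<^sup>2 * x" "x \<ge> 0" for x
    proof -
      have "0 \<le> (4 + 2 / ln \<theta>) * x" using k0 that(2) by simp
      then show ?thesis using that(1) q0 k0 unfolding K_def
        by (simp only: distrib_left distrib_right of_nat_Suc mult_1_right)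
    qed
    have C1: "C_1 P M0 m0 \<ge> 0" unfolding C_1_def using C_2_nonneg[of P M0] by simp
    note nonneg = C1 C_2_nonneg[of P M0] M_bar_pos m_bar_pos primal_gap_nonneg
    let ?l = "log1_plus (max (M_bar P / M0) (m_bar P / m0))"
    have "?l \<ge> 0" unfolding log1_plus_def by simp
    then have "(4 + 2 / ln \<theta>) * ?l \<le> K \<theta> * ?l"
      unfolding K_def using q0 by (intro mult_right_mono) auto
    then have passes: "real (\<Sum>k<Suc n. sub_passes P \<theta> y0 (St k)) \<le> real (Suc n) + K \<theta> * ?l"
      using sum_sub_passes[of "Suc n"]
        budget_le_log1_plus[OF \<theta> M_bar_pos M0_pos m_bar_pos m0_pos] by linarith
    show "\<exists>T. fista_stops P \<theta> y0 M0 m0 \<rho> T \<and>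
        (\<forall>k\<in>{1..T}. stationary_pair P (st_y (St k)) (st_v (St k))) \<and>
        approx_solution P \<rho> (st_y (St T)) (st_v (St T)) \<and>
        real T \<le> K \<theta> *
          ((C_1 P M0 m0 * M_bar P * primal_gap P y0 / \<rho>\<^sup>2) powr (1/3)
           + (C_1 P M0 m0 * M_bar P * m0 * (D_h P)\<^sup>2 / \<rho>\<^sup>2) powr (1/2)
           + C_1 P M0 m0 * M_bar P * (m_bar P * (D_h P)\<^sup>2 + primal_gap P y0) / \<rho>\<^sup>2
           + 1) \<and>
        (m0 \<ge> m_bar P \<longrightarrow>
          real T \<le> K \<theta> *
            ((C_2 P M0 * M_bar P * (primal_gap P y0 + M0 * (d_0 P y0)\<^sup>2) / \<rho>\<^sup>2) powr (1/3)
             + (C_2 P M0 * M_bar P * m0 * (D_h P)\<^sup>2 / \<rho>\<^sup>2) powr (1/2)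
             + C_2 P M0 * M_bar P * m_bar P * (D_h P)\<^sup>2 / \<rho>\<^sup>2
             + 1)) \<and>
        real (\<Sum>k<T. sub_passes P \<theta> y0 (St k)) \<le> real T + K \<theta> * ?l"
    proof (intro exI[of _ "Suc n"] conjI impI)
      show "fista_stops P \<theta> y0 M0 m0 \<rho> (Suc n)"
        unfolding fista_stops_def using small large sub_terminates[OF St_valid] by auto
      show "\<forall>k\<in>{1..Suc n}. stationary_pair P (st_y (St k)) (st_v (St k))"
        using stationary_iterate by simp
      show "approx_solution P \<rho> (st_y (St (Suc n))) (st_v (St (Suc n)))"
        unfolding approx_solution_def using stationary_iterate small by simp
      show "real (Suc n) \<le> K \<theta> *
          ((C_1 P M0 m0 * M_bar P * primal_gap P y0 / \<rho>\<^sup>2) powr (1/3)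
           + (C_1 P M0 m0 * M_bar P * m0 * (D_h P)\<^sup>2 / \<rho>\<^sup>2) powr (1/2)
           + C_1 P M0 m0 * M_bar P * (m_bar P * (D_h P)\<^sup>2 + primal_gap P y0) / \<rho>\<^sup>2
           + 1)"
        by (rule K1[OF outer_bound[OF \<rho> large]]) (use nonneg in simp_all)
      show "real (Suc n) \<le> K \<theta> *
            ((C_2 P M0 * M_bar P * (primal_gap P y0 + M0 * (d_0 P y0)\<^sup>2) / \<rho>\<^sup>2) powr (1/3)
             + (C_2 P M0 * M_bar P * m0 * (D_h P)\<^sup>2 / \<rho>\<^sup>2) powr (1/2)
             + C_2 P M0 * M_bar P * m_bar P * (D_h P)\<^sup>2 / \<rho>\<^sup>2
             + 1)" if "m0 \<ge> m_bar P"
        by (rule K1[OF outer_bound_large_m0[OF \<rho> large that]]) (use nonneg in simp_all)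
    qed (rule passes)
  qed
qed

end
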